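(* Let $0<\nu<1/2$. Let $f:(0,\infty)\to[0,\infty)$ be a sectionally continuous function that does not vanish identically, such that $t\mapsto t^{3/2-3\nu}f(t)$ is decreasing for $t>0$ and $$\int_0^1 t^{\nu+1/2}f(t)\,dt<\infty.$$ Then for all $x>0$, $$(H_\nu f)(x)=\int_0^\infty f(t)\,J_\nu(xt)\sqrt{xt}\,dt>0.$$
   Context: $J_\nu$ is the Bessel function of the first kind of order $\nu$. "Decreasing" means non-increasing. "Sectionally continuous" means piecewise continuous: on each compact subinterval of $(0,\infty)$ there are at most finitely many discontinuities, all with finite one-sided limits. Integrals over $(0,\infty)$ are improper integrals $\lim_{\epsilon\to0+,\,R\to\infty}\int_\epsilon^R$, possibly only conditionally convergent at infinity; the statement includes that this integral converges. *)

theory Defs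
  imports "HOL-Analysis.Analysis"
begin

(* Bessel function of the first kind, by its power series. Meaningful for z > 0 only
   (powr); writing 1/Gamma as rGamma keeps the series correct for every real order. *)
definition bessel_J :: "real \<Rightarrow> real \<Rightarrow> real" where
  "bessel_J \<nu> z =
     (\<Sum>k. (-1) ^ k * rGamma (\<nu> + real k + 1) / fact k * (z / 2) powr (2 * real k + \<nu>))"

(* Functions on (0,\<infinity>) are total functions on the reals whose values outside (0,\<infinity>) are
   irrelevant; isCont at a point t > 0 only sees values near t. *)
definition sectionally_continuous :: "(real \<Rightarrow> real) \<Rightarrow> bool" where
  "sectionally_continuous f \<longleftrightarrow>
     (\<forall>a b. 0 < a \<and> a < b \<longrightarrow>
        finite {t \<in> {a..b}. \<not> isCont f t} \<and>
        (\<forall>t \<in> {a..b}. \<not> isCont f t \<longrightarrow>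
           (\<exists>l. (f \<longlongrightarrow> l) (at_left t)) \<and> (\<exists>r. (f \<longlongrightarrow> r) (at_right t))))"

(* Joint limit of the integrals over [e, R] as e \<rightarrow> 0+ and R \<rightarrow> \<infinity>. Integrability on every [e, R]
   is required because the library's integral is 0 for non-integrable functions. *)
definition has_improper_integral :: "(real \<Rightarrow> real) \<Rightarrow> real \<Rightarrow> bool" where
  "has_improper_integral g I \<longleftrightarrow>
     (\<forall>e R. 0 < e \<and> e < R \<longrightarrow> g integrable_on {e..R}) \<and>
     ((\<lambda>(e, R). integral {e..R} g) \<longlongrightarrow> I) (at_right 0 \<times>\<^sub>F at_top)"

definition improper_integrable :: "(real \<Rightarrow> real) \<Rightarrow> bool" where
  "improper_integrable g \<longleftrightarrow> (\<exists>I. has_improper_integral g I)"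

definition improper_integral :: "(real \<Rightarrow> real) \<Rightarrow> real" where
  "improper_integral g = (THE I. has_improper_integral g I)"

definition hankel_integrand :: "real \<Rightarrow> (real \<Rightarrow> real) \<Rightarrow> real \<Rightarrow> real \<Rightarrow> real" where
  "hankel_integrand \<nu> f x t = f t * bessel_J \<nu> (x * t) * sqrt (x * t)"

definition hankel :: "real \<Rightarrow> (real \<Rightarrow> real) \<Rightarrow> real \<Rightarrow> real" where
  "hankel \<nu> f x = improper_integral (hankel_integrand \<nu> f x)"

end

theory Submission
  imports Defs
begin

text \<open>With \<open>g t = t powr (3/2 - 3\<nu>) * f t\<close> the integrand is \<open>g t\<close> times a constant multiple of
  \<open>t powr (3\<nu> - 1) * J\<^sub>\<nu>(xt)\<close>, so by the second mean value theorem everything reduces to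
  the primitive \<open>F(T) = \<integral>\<^sub>0\<^sup>T t powr (3\<nu> - 1) * J\<^sub>\<nu>(t) dt\<close>. Up to a constant, \<open>F(T)\<close> is
  \<open>T powr (4\<nu>)\<close> times the hypergeometric function \<open>1F2(2\<nu>; \<nu>+1, 2\<nu>+1; -T\<^sup>2/4)\<close>, whereas \<open>J\<^sub>\<nu>\<^sup>2\<close> is
  a power times \<open>1F2(\<nu>+1/2; \<nu>+1, 2\<nu>+1; -z\<^sup>2)\<close>. As \<open>2\<nu> < \<nu> + 1/2\<close>, a beta integral of positive
  weight turns the latter into the former, so \<open>F\<close> is an average of squares and stays above a
  positive constant away from 0. Convergence at infinity follows from Bessel's equation for
  \<open>sqrt t * J\<^sub>\<nu>(t)\<close>.\<close>

section \<open>The Bessel-Clifford function\<close>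

definition clifford_coeff :: "real \<Rightarrow> nat \<Rightarrow> real" where
  "clifford_coeff a k = rGamma (a + real k + 1) / fact k"

text \<open>The Bessel-Clifford function: an entire function with
  \<open>J\<^sub>\<nu>(z) = (z/2) powr \<nu> * clifford \<nu> (-(z\<^sup>2/4))\<close> that is stable under differentiation.\<close>

definition clifford :: "real \<Rightarrow> real \<Rightarrow> real" where
  "clifford a y = (\<Sum>k. clifford_coeff a k * y ^ k)"

lemma clifford_coeff_nonneg:
  assumes "a \<ge> 0"
  shows "clifford_coeff a k \<ge> 0"
  using assms by (simp add: clifford_coeff_def rGamma_inverse_Gamma Gamma_real_nonneg)

text \<open>Each step from \<open>k\<close> to \<open>k + 1\<close> divides
  \<open>rGamma (a + real k + 1)\<close> by \<open>a + real k + 1 \<ge> 1\<close>. This dominates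
  the series by that of \<open>exp\<close>, so it converges everywhere.\<close>

lemma clifford_coeff_le:
  assumes "a \<ge> 0"
  shows "clifford_coeff a k \<le> rGamma (a + 1) / fact k"
proof -
  have "rGamma (a + real k + 1) \<le> rGamma (a + 1)"
  proof (induction k)
    case (Suc k)
    have pos: "rGamma (a + real k + 2) \<ge> 0"
      using assms by (simp add: rGamma_inverse_Gamma Gamma_real_nonneg)
    have "rGamma (a + real k + 2) \<le> (a + real k + 1) * rGamma (a + real k + 2)"
      using pos assms by (simp add: mult_le_cancel_right1)
    also have "\<dots> = rGamma (a + real k + 1)"
      using rGamma_plus1[of "a + real k + 1"] by (simp add: add_ac)
    finally show ?case using Suc by (simp add: add_ac)
  qed simp
  then show ?thesis
    by (simp add: clifford_coeff_def divide_right_mono)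
qed

lemma summable_norm_clifford:
  assumes "a \<ge> 0"
  shows "summable (\<lambda>k. norm (clifford_coeff a k * y ^ k))"
proof (rule summable_comparison_test)
  show "summable (\<lambda>k. rGamma (a + 1) * (\<bar>y\<bar> ^ k /\<^sub>R fact k))"
    by (intro summable_mult summable_exp_generic)
  have "norm (clifford_coeff a k * y ^ k) \<le> rGamma (a + 1) * (\<bar>y\<bar> ^ k /\<^sub>R fact k)" for k
    using mult_right_mono[OF clifford_coeff_le[OF assms, of k], of "\<bar>y\<bar> ^ k"]
      clifford_coeff_nonneg[OF assms, of k]
    by (simp add: abs_mult power_abs divide_inverse mult_ac)
  then show "\<exists>N. \<forall>k\<ge>N. norm (norm (clifford_coeff a k * y ^ k)) \<le> rGamma (a + 1) * (\<bar>y\<bar> ^ k /\<^sub>R fact k)"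
    by auto
qed

lemma summable_clifford: "a \<ge> 0 \<Longrightarrow> summable (\<lambda>k. clifford_coeff a k * y ^ k)"
  by (rule summable_norm_cancel[OF summable_norm_clifford])

lemma clifford_coeff_Suc: "clifford_coeff (a + 1) k = real (Suc k) * clifford_coeff a (Suc k)"
  by (simp add: clifford_coeff_def add_ac divide_simps)

lemma has_real_derivative_clifford:
  assumes "a \<ge> 0"
  shows "(clifford a has_real_derivative clifford (a + 1) y) (at y)"
proof -
  have "((\<lambda>y. \<Sum>k. clifford_coeff a k * y ^ k) has_real_derivative
      (\<Sum>k. diffs (clifford_coeff a) k * y ^ k)) (at y)"
    by (intro termdiffs_strong_converges_everywhere summable_clifford assms)
  then show ?thesis
    by (simp add: clifford_def[abs_def] diffs_def clifford_coeff_Suc)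
qed

text \<open>Together with the derivative rule this is the equation
  \<open>y * C'' + (a + 1) * C' = C\<close> for \<open>C = clifford a\<close>, that is, Bessel's
  equation in the variable \<open>y\<close>. On coefficients, the factor \<open>z\<close> in
  \<open>rGamma z = z * rGamma (z + 1)\<close> splits into \<open>a + 1\<close> and an index that
  cancels against the factorial.\<close>

lemma clifford_recurrence:
  assumes "a \<ge> 0"
  shows "clifford a y = (a + 1) * clifford (a + 1) y + y * clifford (a + 2) y"
proof -
  have coeff: "clifford_coeff a (Suc k) = (a + 1) * clifford_coeff (a + 1) (Suc k) + clifford_coeff (a + 2) k"
    for k
    using rGamma_plus1[of "a + real k + 2"]
    by (simp add: clifford_coeff_def add_ac divide_simps) (simp add: algebra_simps)
  \<comment> \<open>The constant terms are set apart because the factor \<open>y\<close> shifts the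
    series of \<open>clifford (a + 2)\<close> by one index.\<close>
  have tail: "(\<lambda>k. clifford_coeff (a + 1) (Suc k) * y ^ Suc k) sums (clifford (a + 1) y - clifford_coeff (a + 1) 0)"
    using summable_sums[OF summable_clifford[of "a + 1" y]] assms
    by (subst sums_Suc_iff) (simp add: clifford_def)
  have "(\<lambda>k. (a + 1) * (clifford_coeff (a + 1) (Suc k) * y ^ Suc k) + y * (clifford_coeff (a + 2) k * y ^ k))
      sums ((a + 1) * (clifford (a + 1) y - clifford_coeff (a + 1) 0) + y * clifford (a + 2) y)"
    (is "?t sums _")
    unfolding clifford_def[of "a + 2"] using assms
    by (intro sums_add sums_mult tail summable_sums summable_clifford) auto
  also have "?t = (\<lambda>k. clifford_coeff a (Suc k) * y ^ Suc k)"
    by (simp add: coeff algebra_simps)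
  finally have "(\<lambda>k. clifford_coeff a k * y ^ k) sums ((a + 1) * (clifford (a + 1) y - clifford_coeff (a + 1) 0)
      + y * clifford (a + 2) y + clifford_coeff a 0)"
    by (subst (asm) sums_Suc_iff) simp
  then have "clifford a y = (a + 1) * (clifford (a + 1) y - clifford_coeff (a + 1) 0)
      + y * clifford (a + 2) y + clifford_coeff a 0"
    unfolding clifford_def[of a] by (rule sums_unique[symmetric])
  moreover have "clifford_coeff a 0 = (a + 1) * clifford_coeff (a + 1) 0"
    using rGamma_plus1[of "a + 1"] by (simp add: clifford_coeff_def add_ac)
  ultimately show ?thesis by (simp add: algebra_simps)
qed

lemma bessel_J_clifford:
  assumes "\<nu> \<ge> 0" and "z > 0"
  shows "bessel_J \<nu> z = (z / 2) powr \<nu> * clifford \<nu> (- (z\<^sup>2 / 4))"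
proof -
  have "(-1) ^ k * rGamma (\<nu> + real k + 1) / fact k * (z / 2) powr (2 * real k + \<nu>) =
      (z / 2) powr \<nu> * (clifford_coeff \<nu> k * (- (z\<^sup>2 / 4)) ^ k)" for k
  proof -
    have "(z / 2) powr (2 * real k + \<nu>) = (z / 2) powr \<nu> * (z / 2) powr real (2 * k)"
      by (simp add: powr_add mult.commute)
    also have "(z / 2) powr real (2 * k) = (z\<^sup>2 / 4) ^ k"
      using assms by (subst powr_realpow) (simp_all add: power_mult power_divide)
    finally show ?thesis
      by (subst power_minus) (simp add: clifford_coeff_def)
  qed
  then have "bessel_J \<nu> z = (\<Sum>k. (z / 2) powr \<nu> * (clifford_coeff \<nu> k * (- (z\<^sup>2 / 4)) ^ k))"
    by (simp only: bessel_J_def)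
  also have "\<dots> = (z / 2) powr \<nu> * clifford \<nu> (- (z\<^sup>2 / 4))"
    unfolding clifford_def by (intro suminf_mult summable_clifford assms)
  finally show ?thesis .
qed

section \<open>The square of the Bessel-Clifford function\<close>

definition clifford_sq_coeff :: "real \<Rightarrow> nat \<Rightarrow> real" where
  "clifford_sq_coeff a k = (\<Sum>i\<le>k. clifford_coeff a i * clifford_coeff a (k - i))"

lemma clifford_sq_sums:
  assumes "a \<ge> 0"
  shows "(\<lambda>k. clifford_sq_coeff a k * y ^ k) sums (clifford a y)\<^sup>2"
proof -
  have "(\<lambda>k. \<Sum>i\<le>k. (clifford_coeff a i * y ^ i) * (clifford_coeff a (k - i) * y ^ (k - i)))
      sums (clifford a y * clifford a y)"
    unfolding clifford_def by (intro Cauchy_product_sums summable_norm_clifford assms)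
  also have "(\<lambda>k. \<Sum>i\<le>k. (clifford_coeff a i * y ^ i) * (clifford_coeff a (k - i) * y ^ (k - i)))
      = (\<lambda>k. clifford_sq_coeff a k * y ^ k)"
  proof
    fix k
    show "(\<Sum>i\<le>k. (clifford_coeff a i * y ^ i) * (clifford_coeff a (k - i) * y ^ (k - i)))
      = clifford_sq_coeff a k * y ^ k"
      unfolding clifford_sq_coeff_def sum_distrib_right
    proof (intro sum.cong refl)
      fix i assume "i \<in> {..k}"
      then have "y ^ k = y ^ i * y ^ (k - i)"
        by (simp flip: power_add)
      then show "(clifford_coeff a i * y ^ i) * (clifford_coeff a (k - i) * y ^ (k - i))
          = clifford_coeff a i * clifford_coeff a (k - i) * y ^ k"
        by simp
    qed
  qed
  finally show ?thesis by (simp add: power2_eq_square)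
qed

lemma clifford_sq_coeff_nonneg: "a \<ge> 0 \<Longrightarrow> clifford_sq_coeff a k \<ge> 0"
  by (simp add: clifford_sq_coeff_def sum_nonneg clifford_coeff_nonneg)

lemma not_nonpos_Int_of_pos: "x > 0 \<Longrightarrow> x \<notin> \<int>\<^sub>\<le>\<^sub>0" for x :: real
  by (auto elim!: nonpos_Ints_cases)

text \<open>Each product of coefficients is a product of two binomials with the same upper entry
  \<open>a + k\<close>, so the Cauchy sum is a Vandermonde convolution.\<close>

lemma clifford_sq_coeff_eq:
  assumes "a \<ge> 0"
  shows "clifford_sq_coeff a k = ((2 * a + 2 * real k) gchoose k) * (rGamma (a + real k + 1))\<^sup>2"
proof -
  have "clifford_coeff a i * clifford_coeff a (k - i)
      = (((a + real k) gchoose i) * ((a + real k) gchoose (k - i))) * (rGamma (a + real k + 1))\<^sup>2"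
    if "i \<le> k" for i
  proof -
    have notin: "a + real k + 1 \<notin> \<int>\<^sub>\<le>\<^sub>0"
      using assms by (intro not_nonpos_Int_of_pos) simp
    have pos: "Gamma (a + real k + 1) > 0"
      using assms by (intro Gamma_real_pos) simp
    have i: "(a + real k) gchoose i
        = Gamma (a + real k + 1) / (fact i * Gamma (a + real (k - i) + 1))"
      using gbinomial_Gamma[OF notin, of i] that by (simp add: of_nat_diff algebra_simps)
    have j: "(a + real k) gchoose (k - i)
        = Gamma (a + real k + 1) / (fact (k - i) * Gamma (a + real i + 1))"
      using gbinomial_Gamma[OF notin, of "k - i"] that by (simp add: of_nat_diff algebra_simps)
    show ?thesis
      unfolding i j using pos by (simp add: clifford_coeff_def rGamma_inverse_Gamma power2_eq_square divide_simps)
  qed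
  then have "clifford_sq_coeff a k
      = (\<Sum>i\<in>{0..k}. ((a + real k) gchoose i) * ((a + real k) gchoose (k - i))) * (rGamma (a + real k + 1))\<^sup>2"
    unfolding clifford_sq_coeff_def sum_distrib_right by (intro sum.cong) auto
  then show ?thesis
    unfolding gbinomial_Vandermonde by (simp add: algebra_simps)
qed

section \<open>Beta integral of the square\<close>

lemma Gamma_legendre_duplication_real:
  assumes "x > 0"
  shows "Gamma x * Gamma (x + 1 / 2) = 2 powr (1 - 2 * x) * sqrt pi * Gamma (2 * x :: real)"
proof -
  have notin: "complex_of_real y \<notin> \<int>\<^sub>\<le>\<^sub>0" if "y > 0" for y
    using not_nonpos_Int_of_pos[OF that] by (simp add: of_real_in_nonpos_Ints_iff)
  have "complex_of_real x + 1 / 2 \<notin> \<int>\<^sub>\<le>\<^sub>0"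
    using notin[of "x + 1 / 2"] assms by simp
  from Gamma_legendre_duplication[OF notin[OF assms] this]
  have "complex_of_real (Gamma x * Gamma (x + 1 / 2))
      = complex_of_real (exp ((1 - 2 * x) * ln 2) * sqrt pi * Gamma (2 * x))"
    by (simp flip: Gamma_complex_of_real exp_of_real)
  then show ?thesis
    by (simp only: of_real_eq_iff powr_def) simp
qed

text \<open>The beta moment of \<open>s ^ k\<close> turns the \<open>k\<close>-th coefficient of the
  square into that of the primitive, up to a factor independent of \<open>k\<close>. The duplication
  formula removes \<open>E\<close>, and the denominator of the Beta value removes \<open>A\<close>.
  The bound \<open>\<nu> < 1 / 2\<close> makes the second Beta parameter positive.\<close>

lemma clifford_sq_coeff_Beta:
  assumes "0 < \<nu>" and "\<nu> < 1 / 2"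
  shows "clifford_sq_coeff \<nu> k / 4 ^ k * Beta (2 * \<nu> + real k) (1 / 2 - \<nu>)
      = 2 * 4 powr \<nu> * Gamma (1 / 2 - \<nu>) / sqrt pi * (clifford_coeff \<nu> k / (4 * \<nu> + 2 * real k))"
proof -
  define A B C E where "A = Gamma (\<nu> + real k + 1 / 2)" and "B = Gamma (\<nu> + real k + 1)"
    and "C = Gamma (2 * \<nu> + real k)" and "E = Gamma (2 * \<nu> + 2 * real k + 1)"
  have pos: "A > 0" "B > 0" "C > 0" "E > 0"
    using assms by (auto simp: A_def B_def C_def E_def intro!: Gamma_real_pos)
  \<comment> \<open>Duplication at \<open>\<nu> + k + 1 / 2\<close>.\<close>
  have dup: "A * B * (4 powr \<nu> * 4 ^ k) = sqrt pi * E"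
  proof -
    have "(2::real) powr (1 - 2 * (\<nu> + real k + 1 / 2)) = 4 powr - (\<nu> + real k)"
      using powr_powr[of 2 2 "- (\<nu> + real k)"] by (simp add: algebra_simps)
    also have "\<dots> = 1 / (4 powr \<nu> * 4 ^ k)"
      by (subst powr_minus_divide) (simp add: powr_add powr_realpow)
    finally show ?thesis
      using Gamma_legendre_duplication_real[of "\<nu> + real k + 1 / 2"] assms
      by (simp add: A_def B_def E_def algebra_simps)
  qed
  \<comment> \<open>Splitting \<open>2 * \<nu> + k\<close> off the Gamma value leaves
    \<open>C\<close>, which the Beta value cancels; the split factor becomes, after doubling, the
    denominator \<open>4 * \<nu> + 2 * k\<close>.\<close>
  have "(2 * \<nu> + 2 * real k) gchoose k = E / (fact k * ((2 * \<nu> + real k) * C))"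
  proof -
    have "Gamma (2 * \<nu> + real k + 1) = (2 * \<nu> + real k) * C"
      unfolding C_def using assms by (intro Gamma_plus1 not_nonpos_Int_of_pos) simp
    moreover have "2 * \<nu> + 2 * real k + 1 \<notin> \<int>\<^sub>\<le>\<^sub>0"
      using assms by (intro not_nonpos_Int_of_pos) simp
    ultimately show ?thesis
      using gbinomial_Gamma[of "2 * \<nu> + 2 * real k" k] by (simp add: E_def add_ac)
  qed
  then have "clifford_sq_coeff \<nu> k = E / (fact k * ((2 * \<nu> + real k) * C) * B\<^sup>2)"
    using assms pos by (simp add: clifford_sq_coeff_eq B_def rGamma_inverse_Gamma divide_simps)
  moreover have "Beta (2 * \<nu> + real k) (1 / 2 - \<nu>) = C * Gamma (1 / 2 - \<nu>) / A"
    by (simp add: Beta_def A_def C_def algebra_simps)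
  moreover have "E = A * B * (4 powr \<nu> * 4 ^ k) / sqrt pi"
    using dup by (simp add: field_simps)
  ultimately have "clifford_sq_coeff \<nu> k / 4 ^ k * Beta (2 * \<nu> + real k) (1 / 2 - \<nu>)
      = A * B * (4 powr \<nu> * 4 ^ k) / sqrt pi / (fact k * ((2 * \<nu> + real k) * C) * B\<^sup>2) / 4 ^ k * (C * Gamma (1 / 2 - \<nu>) / A)"
    by simp
  also have "\<dots> = 4 powr \<nu> * Gamma (1 / 2 - \<nu>) / sqrt pi * (1 / (fact k * B * (2 * \<nu> + real k)))"
    using pos assms by (simp add: power2_eq_square)
  also have "\<dots> = 2 * 4 powr \<nu> * Gamma (1 / 2 - \<nu>) / sqrt pi * (1 / (fact k * B * (4 * \<nu> + 2 * real k)))"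
  proof -
    define u where "u = 2 * \<nu> + real k"
    have "4 * \<nu> + 2 * real k = 2 * u" by (simp add: u_def)
    then show ?thesis by (simp flip: u_def)
  qed
  also have "1 / (fact k * B * u) = clifford_coeff \<nu> k / u" for u
    by (simp add: clifford_coeff_def B_def rGamma_inverse_Gamma field_simps)
  finally show ?thesis .
qed

text \<open>The solution \<open>P\<close>, analytic at 0, of \<open>4 * \<nu> * P + 2 * y * P' = clifford \<nu> y\<close>; the equation makes
  \<open>t powr (4\<nu>) * P(-(t\<^sup>2/4))\<close> a primitive of \<open>t powr (4\<nu> - 1) * clifford \<nu> (-(t\<^sup>2/4))\<close>.\<close>

definition clifford_int :: "real \<Rightarrow> real \<Rightarrow> real" where
  "clifford_int \<nu> y = (\<Sum>k. clifford_coeff \<nu> k / (4 * \<nu> + 2 * real k) * y ^ k)"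

lemma summable_clifford_int:
  assumes "\<nu> > 0"
  shows "summable (\<lambda>k. clifford_coeff \<nu> k / (4 * \<nu> + 2 * real k) * y ^ k)"
proof (rule summable_comparison_test)
  show "summable (\<lambda>k. 1 / (4 * \<nu>) * norm (clifford_coeff \<nu> k * y ^ k))"
    using assms by (intro summable_mult summable_norm_clifford) simp
  have "norm (clifford_coeff \<nu> k / (4 * \<nu> + 2 * real k) * y ^ k) \<le> 1 / (4 * \<nu>) * norm (clifford_coeff \<nu> k * y ^ k)"
    for k
  proof -
    have "norm (clifford_coeff \<nu> k / (4 * \<nu> + 2 * real k) * y ^ k)
        = 1 / (4 * \<nu> + 2 * real k) * norm (clifford_coeff \<nu> k * y ^ k)"
      using assms by (simp add: abs_mult)
    also have "\<dots> \<le> 1 / (4 * \<nu>) * norm (clifford_coeff \<nu> k * y ^ k)"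
      using assms by (intro mult_right_mono divide_left_mono) auto
    finally show ?thesis .
  qed
  then show "\<exists>N. \<forall>k\<ge>N. norm (clifford_coeff \<nu> k / (4 * \<nu> + 2 * real k) * y ^ k)
      \<le> 1 / (4 * \<nu>) * norm (clifford_coeff \<nu> k * y ^ k)"
    by blast
qed

text \<open>The series of the square is integrated term by term against the beta weight. The
  integrand is nonnegative, which gives a sign to \<open>clifford_int\<close> even for
  \<open>y < 0\<close>, where its series alternates.\<close>

lemma has_integral_clifford_sq:
  assumes \<nu>: "0 < \<nu>" "\<nu> < 1 / 2"
  shows "((\<lambda>s. s powr (2 * \<nu> - 1) * (1 - s) powr (- 1 / 2 - \<nu>) * (clifford \<nu> (y * s / 4))\<^sup>2)
    has_integral (2 * 4 powr \<nu> * Gamma (1 / 2 - \<nu>) / sqrt pi * clifford_int \<nu> y)) {0..1}"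
proof -
  define W where "W = (\<lambda>s::real. s powr (2 * \<nu> - 1) * (1 - s) powr (- 1 / 2 - \<nu>))"
  define d where "d = (\<lambda>k. clifford_sq_coeff \<nu> k * (y / 4) ^ k)"
  define c where "c = 2 * 4 powr \<nu> * Gamma (1 / 2 - \<nu>) / sqrt pi"
  have W_nonneg: "W s \<ge> 0" for s
    by (simp add: W_def)
  have W_integral: "((\<lambda>s. W s * s ^ k) has_integral Beta (2 * \<nu> + real k) (1 / 2 - \<nu>)) {0..1}" for k
  proof -
    have "((\<lambda>s. s powr (2 * \<nu> + real k - 1) * (1 - s) powr (1 / 2 - \<nu> - 1))
        has_integral Beta (2 * \<nu> + real k) (1 / 2 - \<nu>)) {0..1}"
      using \<nu> by (intro has_integral_Beta_real) auto
    moreover have "s powr (2 * \<nu> + real k - 1) * (1 - s) powr (1 / 2 - \<nu> - 1) = W s * s ^ k"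
      if "s \<in> {0..1}" for s
    proof (cases "s = 0")
      case False
      have "s powr (2 * \<nu> + real k - 1) = s powr (2 * \<nu> - 1) * s ^ k"
        using that False by (subst powr_realpow[symmetric]) (auto simp flip: powr_add simp: algebra_simps)
      moreover have "1 / 2 - \<nu> - 1 = - 1 / 2 - \<nu>" by simp
      ultimately show ?thesis by (simp add: W_def)
    \<comment> \<open>At \<open>s = 0\<close> both sides are 0, for every \<open>k\<close>, because
      \<open>0 powr _ = 0\<close>.\<close>
    qed (simp add: W_def)
    ultimately show ?thesis by (metis (no_types, lifting) has_integral_cong)
  qed
  have sums_d: "(\<lambda>k. d k * s ^ k) sums (clifford \<nu> (y * s / 4))\<^sup>2" for s
    using clifford_sq_sums[of \<nu> "y * s / 4"] \<nu>
    by (simp add: d_def power_mult_distrib power_divide mult_ac)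
  \<comment> \<open>All coefficients of the square are nonnegative, so the sum of absolute values is
    again a square. On \<open>{0..1}\<close> it bounds every partial sum, and a multiple of
    \<open>W\<close> dominates.\<close>
  have abs_d: "(\<lambda>k. \<bar>d k\<bar>) sums (clifford \<nu> (\<bar>y\<bar> / 4))\<^sup>2"
    using clifford_sq_sums[of \<nu> "\<bar>y\<bar> / 4"] clifford_sq_coeff_nonneg[of \<nu>] \<nu>
    by (simp add: d_def abs_mult power_abs)
  have "((\<lambda>s. W s * (clifford \<nu> (y * s / 4))\<^sup>2) has_integral c * clifford_int \<nu> y) {0..1}"
  proof (rule has_integral_dominated_convergence)
    show "((\<lambda>s. \<Sum>k<n. d k * (W s * s ^ k)) has_integral
        (\<Sum>k<n. d k * Beta (2 * \<nu> + real k) (1 / 2 - \<nu>))) {0..1}" for n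
      by (intro has_integral_sum has_integral_mult_right W_integral finite_lessThan)
    show "(\<lambda>s. W s * (clifford \<nu> (\<bar>y\<bar> / 4))\<^sup>2) integrable_on {0..1}"
      using W_integral[of 0] by (intro integrable_on_mult_left) (auto simp: integrable_on_def)
    show "\<forall>s\<in>{0..1}. norm (\<Sum>k<n. d k * (W s * s ^ k)) \<le> W s * (clifford \<nu> (\<bar>y\<bar> / 4))\<^sup>2" for n
    proof
      fix s :: real assume s: "s \<in> {0..1}"
      have "norm (\<Sum>k<n. d k * (W s * s ^ k)) \<le> (\<Sum>k<n. norm (d k * (W s * s ^ k)))"
        by (rule norm_sum)
      also have "\<dots> \<le> (\<Sum>k<n. W s * \<bar>d k\<bar>)"
      proof (rule sum_mono)
        fix k
        have "s ^ k \<le> 1" using s by (auto intro: power_le_one)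
        then have "\<bar>d k\<bar> * W s * s ^ k \<le> \<bar>d k\<bar> * W s * 1"
          using W_nonneg by (intro mult_left_mono) auto
        then show "norm (d k * (W s * s ^ k)) \<le> W s * \<bar>d k\<bar>"
          using s W_nonneg[of s] by (simp add: abs_mult mult_ac)
      qed
      also have "\<dots> = W s * (\<Sum>k<n. \<bar>d k\<bar>)" by (simp add: sum_distrib_left)
      also have "\<dots> \<le> W s * (clifford \<nu> (\<bar>y\<bar> / 4))\<^sup>2"
        using abs_d W_nonneg
        by (intro mult_left_mono) (auto simp: sums_iff intro!: sum_le_suminf[where f = "\<lambda>k. \<bar>d k\<bar>", THEN order_trans])
      finally show "norm (\<Sum>k<n. d k * (W s * s ^ k)) \<le> W s * (clifford \<nu> (\<bar>y\<bar> / 4))\<^sup>2" .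
    qed
    show "\<forall>s\<in>{0..1}. (\<lambda>n. \<Sum>k<n. d k * (W s * s ^ k)) \<longlonglongrightarrow> W s * (clifford \<nu> (y * s / 4))\<^sup>2"
    proof
      fix s :: real
      show "(\<lambda>n. \<Sum>k<n. d k * (W s * s ^ k)) \<longlonglongrightarrow> W s * (clifford \<nu> (y * s / 4))\<^sup>2"
        using sums_mult[OF sums_d[of s], of "W s"] by (simp add: sums_def mult_ac)
    qed
    have "d k * Beta (2 * \<nu> + real k) (1 / 2 - \<nu>)
        = c * (clifford_coeff \<nu> k / (4 * \<nu> + 2 * real k) * y ^ k)" for k
    proof -
      have "d k * Beta (2 * \<nu> + real k) (1 / 2 - \<nu>)
          = (clifford_sq_coeff \<nu> k / 4 ^ k * Beta (2 * \<nu> + real k) (1 / 2 - \<nu>)) * y ^ k"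
        by (simp add: d_def power_divide)
      then show ?thesis
        unfolding clifford_sq_coeff_Beta[OF \<nu>] c_def by simp
    qed
    moreover have "(\<lambda>k. c * (clifford_coeff \<nu> k / (4 * \<nu> + 2 * real k) * y ^ k)) sums (c * clifford_int \<nu> y)"
      unfolding clifford_int_def by (intro sums_mult summable_sums summable_clifford_int \<nu>)
    ultimately show "(\<lambda>n. \<Sum>k<n. d k * Beta (2 * \<nu> + real k) (1 / 2 - \<nu>)) \<longlonglongrightarrow> c * clifford_int \<nu> y"
      by (simp add: sums_def)
  qed
  then show ?thesis
    by (simp add: W_def c_def)
qed

section \<open>The primitive of the kernel\<close>

text \<open>This is \<open>2 powr \<nu>\<close> times the integral \<open>F\<close> of the overview,
  in closed form so that the integral of squares applies to it.\<close>

definition bessel_primitive :: "real \<Rightarrow> real \<Rightarrow> real" where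
  "bessel_primitive \<nu> t = t powr (4 * \<nu>) * clifford_int \<nu> (- (t\<^sup>2 / 4))"

text \<open>Multiplying the derivative by \<open>y\<close> multiplies the \<open>k\<close>-th
  coefficient by \<open>k\<close>, so the left side of the equation has coefficients
  \<open>(4 * \<nu> + 2 * k) * b k\<close>. The derivative stays anonymous: only the equation and
  differentiability are used later.\<close>

lemma has_real_derivative_clifford_int:
  assumes "\<nu> > 0"
  obtains D where "(clifford_int \<nu> has_real_derivative D) (at y)"
    and "4 * \<nu> * clifford_int \<nu> y + 2 * y * D = clifford \<nu> y"
proof
  define b where "b = (\<lambda>k. clifford_coeff \<nu> k / (4 * \<nu> + 2 * real k))"
  define D where "D = (\<Sum>k. diffs b k * y ^ k)"
  have summable_b: "summable (\<lambda>k. b k * z ^ k)" for z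
    unfolding b_def by (rule summable_clifford_int[OF assms])
  show "(clifford_int \<nu> has_real_derivative D) (at y)"
    using termdiffs_strong_converges_everywhere[OF summable_b, of y]
    by (simp add: clifford_int_def[abs_def] b_def D_def)
  have "summable (\<lambda>k. diffs b k * y ^ k)"
    by (intro termdiff_converges_all summable_b)
  then have "(\<lambda>k. y * (diffs b k * y ^ k)) sums (y * D)"
    unfolding D_def by (intro sums_mult summable_sums)
  then have "(\<lambda>k. real (Suc k) * b (Suc k) * y ^ Suc k) sums (y * D)"
    by (simp add: diffs_def mult_ac)
  \<comment> \<open>The index shift is free because the term at \<open>k = 0\<close>
    vanishes.\<close>
  then have "(\<lambda>k. real k * b k * y ^ k) sums (y * D)"
    using sums_Suc_iff[of "\<lambda>k. real k * b k * y ^ k" "y * D"] by simp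
  then have "(\<lambda>k. 4 * \<nu> * (b k * y ^ k) + 2 * (real k * b k * y ^ k)) sums
      (4 * \<nu> * (\<Sum>k. b k * y ^ k) + 2 * (y * D))"
    by (intro sums_add sums_mult summable_sums summable_b)
  moreover have "(\<Sum>k. b k * y ^ k) = clifford_int \<nu> y"
    by (simp add: clifford_int_def b_def)
  moreover have "4 * \<nu> * (b k * y ^ k) + 2 * (real k * b k * y ^ k) = clifford_coeff \<nu> k * y ^ k" for k
  proof -
    have "(4 * \<nu> + 2 * real k) * b k = clifford_coeff \<nu> k"
      using assms by (simp add: b_def)
    then show ?thesis by (metis (no_types, opaque_lifting) distrib_right mult.assoc)
  qed
  ultimately show "4 * \<nu> * clifford_int \<nu> y + 2 * y * D = clifford \<nu> y"
    by (simp add: clifford_def sums_iff)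
qed

lemma has_real_derivative_bessel_primitive:
  assumes "\<nu> > 0" "t > 0"
  shows "(bessel_primitive \<nu> has_real_derivative t powr (4 * \<nu> - 1) * clifford \<nu> (- (t\<^sup>2 / 4))) (at t)"
proof -
  obtain D where D: "(clifford_int \<nu> has_real_derivative D) (at (- (t\<^sup>2 / 4)))"
    and eq: "4 * \<nu> * clifford_int \<nu> (- (t\<^sup>2 / 4)) + 2 * (- (t\<^sup>2 / 4)) * D = clifford \<nu> (- (t\<^sup>2 / 4))"
    by (rule has_real_derivative_clifford_int[OF assms(1)])
  have "((\<lambda>t. - (t\<^sup>2 / 4)) has_real_derivative (- (t / 2))) (at t)"
    by (auto intro!: derivative_eq_intros)
  from DERIV_chain2[OF D this]
  have "(bessel_primitive \<nu> has_real_derivative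
      4 * \<nu> * t powr (4 * \<nu> - 1) * clifford_int \<nu> (- (t\<^sup>2 / 4)) + D * (- (t / 2)) * t powr (4 * \<nu>)) (at t)"
    unfolding bessel_primitive_def[abs_def]
    by (intro DERIV_mult has_real_derivative_powr assms)
  also have "4 * \<nu> * t powr (4 * \<nu> - 1) * clifford_int \<nu> (- (t\<^sup>2 / 4)) + D * (- (t / 2)) * t powr (4 * \<nu>)
      = t powr (4 * \<nu> - 1) * (4 * \<nu> * clifford_int \<nu> (- (t\<^sup>2 / 4)) + 2 * (- (t\<^sup>2 / 4)) * D)"
    using assms by (simp add: powr_diff power2_eq_square field_simps)
  finally show ?thesis by (simp only: eq)
qed

text \<open>This fixes the constant of integration: the primitive is the integral from 0. The
  positive exponent \<open>4 * \<nu>\<close> forces the limit.\<close>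

lemma bessel_primitive_tendsto_0:
  assumes "\<nu> > 0"
  shows "(bessel_primitive \<nu> \<longlongrightarrow> 0) (at_right 0)"
proof -
  obtain D where "(clifford_int \<nu> has_real_derivative D) (at 0)"
    by (rule has_real_derivative_clifford_int[OF assms])
  then have cont: "isCont (clifford_int \<nu>) 0"
    by (rule DERIV_isCont)
  have "((\<lambda>t::real. - (t\<^sup>2 / 4)) \<longlongrightarrow> - (0\<^sup>2 / 4)) (at_right 0)"
    by (rule tendsto_intros | simp)+
  then have lim: "((\<lambda>t::real. - (t\<^sup>2 / 4)) \<longlongrightarrow> 0) (at_right 0)"
    by simp
  have "((\<lambda>t. clifford_int \<nu> (- (t\<^sup>2 / 4))) \<longlongrightarrow> clifford_int \<nu> 0) (at_right 0)"
    by (rule isCont_tendsto_compose[OF cont lim])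
  moreover have "((\<lambda>t::real. t powr (4 * \<nu>)) \<longlongrightarrow> 0 powr (4 * \<nu>)) (at_right 0)"
    by (rule tendsto_powr'[OF tendsto_ident_at tendsto_const]) (use assms in \<open>auto simp: eventually_at_filter\<close>)
  ultimately have "((\<lambda>t. t powr (4 * \<nu>) * clifford_int \<nu> (- (t\<^sup>2 / 4))) \<longlongrightarrow> 0 powr (4 * \<nu>) * clifford_int \<nu> 0) (at_right 0)"
    by (intro tendsto_mult)
  then show ?thesis
    by (simp add: bessel_primitive_def[abs_def])
qed

section \<open>Positivity of the primitive\<close>

lemma clifford_pos_near_0:
  assumes "\<nu> > 0"
  obtains \<eta> where "\<eta> > 0" and "\<And>y. \<bar>y\<bar> \<le> \<eta> \<Longrightarrow> clifford \<nu> y \<ge> rGamma (\<nu> + 1) / 2"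
proof -
  have pos: "rGamma (\<nu> + 1) > 0"
    using assms by (simp add: rGamma_inverse_Gamma Gamma_real_pos)
  \<comment> \<open>The value at 0 is the positive constant term; by continuity half of it remains a
    lower bound nearby.\<close>
  have "clifford \<nu> 0 = rGamma (\<nu> + 1)"
    using powser_zero[of "clifford_coeff \<nu>"] by (simp add: clifford_def clifford_coeff_def)
  moreover have "isCont (clifford \<nu>) 0"
    using assms by (intro DERIV_isCont[OF has_real_derivative_clifford]) simp
  ultimately have "(clifford \<nu> \<longlongrightarrow> rGamma (\<nu> + 1)) (nhds 0)"
    by (simp add: tendsto_nhds_iff continuous_at)
  then have "\<forall>\<^sub>F y in nhds 0. clifford \<nu> y > rGamma (\<nu> + 1) / 2"
    using pos by (intro order_tendstoD(1)) auto
  then obtain d where "d > 0" and d: "\<And>y. dist y 0 < d \<Longrightarrow> clifford \<nu> y > rGamma (\<nu> + 1) / 2"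
    unfolding eventually_nhds_metric by blast
  show thesis
    using \<open>d > 0\<close> d by (intro that[of "d / 2"]) (auto simp: dist_real_def less_imp_le)
qed

text \<open>In the integral of squares only \<open>s \<le> m = \<mu> / t\<^sup>2\<close> is kept,
  where the argument of \<open>clifford\<close> is near 0. This part contributes a multiple of
  \<open>m powr (2 * \<nu>)\<close>, and the prefactor \<open>t powr (4 * \<nu>)\<close> cancels its
  dependence on \<open>t\<close>.\<close>

lemma bessel_primitive_lower_bound:
  assumes \<nu>: "0 < \<nu>" "\<nu> < 1 / 2" and "a > 0"
  obtains \<delta> where "\<delta> > 0" and "\<And>t. t \<ge> a \<Longrightarrow> bessel_primitive \<nu> t \<ge> \<delta>"
proof -
  define c where "c = 2 * 4 powr \<nu> * Gamma (1 / 2 - \<nu>) / sqrt pi"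
  have "c > 0"
    using \<nu> by (auto simp: c_def intro!: Gamma_real_pos mult_pos_pos divide_pos_pos)
  obtain \<eta> where "\<eta> > 0" and \<eta>: "\<And>y. \<bar>y\<bar> \<le> \<eta> \<Longrightarrow> clifford \<nu> y \<ge> rGamma (\<nu> + 1) / 2"
    using clifford_pos_near_0[OF \<nu>(1)] by metis
  define \<kappa> where "\<kappa> = (rGamma (\<nu> + 1) / 2)\<^sup>2"
  have rG: "rGamma (\<nu> + 1) > 0"
    using \<nu> by (simp add: rGamma_inverse_Gamma Gamma_real_pos)
  then have "\<kappa> > 0" by (simp add: \<kappa>_def)
  \<comment> \<open>The bound \<open>\<eta>\<close> keeps the argument where \<open>clifford\<close>
    is bounded below; \<open>a\<^sup>2 / 2\<close> makes \<open>m < 1\<close> for every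
    \<open>t \<ge> a\<close>.\<close>
  define \<mu> where "\<mu> = min \<eta> (a\<^sup>2 / 2)"
  have "\<mu> > 0" using \<open>\<eta> > 0\<close> \<open>a > 0\<close> by (simp add: \<mu>_def)
  have "\<mu> < a\<^sup>2" using \<open>a > 0\<close> by (simp add: \<mu>_def min_less_iff_disj)
  define \<delta> where "\<delta> = \<kappa> * (\<mu> powr (2 * \<nu>) / (2 * \<nu>)) / c"
  show thesis
  proof (rule that)
    show "\<delta> > 0"
      using \<open>\<kappa> > 0\<close> \<open>\<mu> > 0\<close> \<open>c > 0\<close> \<nu> by (simp add: \<delta>_def)
    fix t assume "t \<ge> a"
    then have "t > 0" using \<open>a > 0\<close> by simp
    have "a\<^sup>2 \<le> t\<^sup>2" using \<open>t \<ge> a\<close> \<open>a > 0\<close> by (intro power_mono) auto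
    define m where "m = \<mu> / t\<^sup>2"
    have m: "0 < m" "m < 1"
      using \<open>\<mu> > 0\<close> \<open>t > 0\<close> \<open>a\<^sup>2 \<le> t\<^sup>2\<close> \<open>\<mu> < a\<^sup>2\<close> by (auto simp: m_def)
    define h where "h = (\<lambda>s. s powr (2 * \<nu> - 1) * (1 - s) powr (- 1 / 2 - \<nu>) * (clifford \<nu> (- (t\<^sup>2 / 4) * s / 4))\<^sup>2)"
    have h: "(h has_integral c * clifford_int \<nu> (- (t\<^sup>2 / 4))) {0..1}"
      unfolding h_def c_def by (rule has_integral_clifford_sq[OF \<nu>])
    have low: "((\<lambda>s. if s \<in> {0..m} then \<kappa> * s powr (2 * \<nu> - 1) else 0) has_integral
        (\<kappa> * (m powr (2 * \<nu>) / (2 * \<nu>)))) {0..1}"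
    proof (subst has_integral_restrict)
      have "((\<lambda>s. s powr (2 * \<nu> - 1)) has_integral (m powr (2 * \<nu> - 1 + 1) / (2 * \<nu> - 1 + 1))) {0..m}"
        using \<nu> m by (intro has_integral_powr_from_0) auto
      then show "((\<lambda>s. \<kappa> * s powr (2 * \<nu> - 1)) has_integral (\<kappa> * (m powr (2 * \<nu>) / (2 * \<nu>)))) {0..m}"
        by (intro has_integral_mult_right) simp
    qed (use m in auto)
    have "\<kappa> * (m powr (2 * \<nu>) / (2 * \<nu>)) \<le> c * clifford_int \<nu> (- (t\<^sup>2 / 4))"
    proof (rule has_integral_le[OF low h])
      fix s :: real assume "s \<in> {0..1}"
      show "(if s \<in> {0..m} then \<kappa> * s powr (2 * \<nu> - 1) else 0) \<le> h s"
      proof (cases "s \<in> {0..m}")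
        case False
        then show ?thesis by (auto simp: h_def)
      next
        case True
        have "t\<^sup>2 * s \<le> \<mu>"
          using True \<open>t > 0\<close> by (auto simp: m_def field_simps)
        then have "\<bar>- (t\<^sup>2 / 4) * s / 4\<bar> \<le> \<eta>"
          using True \<open>\<eta> > 0\<close> by (simp add: abs_mult \<mu>_def)
        then have "\<kappa> \<le> (clifford \<nu> (- (t\<^sup>2 / 4) * s / 4))\<^sup>2"
          unfolding \<kappa>_def using \<eta> rG by (intro power_mono) auto
        \<comment> \<open>Here \<open>m < 1\<close> matters: at \<open>s = 1\<close> the weight
          would be \<open>0 powr _ = 0\<close>.\<close>
        moreover have "1 \<le> (1 - s) powr (- 1 / 2 - \<nu>)"
          using True m \<nu> powr_mono2'[of "- 1 / 2 - \<nu>" "1 - s" 1] by simp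
        ultimately have "1 * \<kappa> \<le> (1 - s) powr (- 1 / 2 - \<nu>) * (clifford \<nu> (- (t\<^sup>2 / 4) * s / 4))\<^sup>2"
          using \<open>\<kappa> > 0\<close> by (intro mult_mono) auto
        then have "s powr (2 * \<nu> - 1) * (1 * \<kappa>) \<le> h s"
          unfolding h_def mult.assoc by (intro mult_left_mono) auto
        then show ?thesis using True by (simp add: mult.commute)
      qed
    qed
    then have "\<kappa> * (m powr (2 * \<nu>) / (2 * \<nu>)) / c \<le> clifford_int \<nu> (- (t\<^sup>2 / 4))"
      using \<open>c > 0\<close> by (simp only: pos_divide_le_eq mult.commute)
    then have "t powr (4 * \<nu>) * (\<kappa> * (m powr (2 * \<nu>) / (2 * \<nu>)) / c) \<le> bessel_primitive \<nu> t"
      unfolding bessel_primitive_def by (intro mult_left_mono) auto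
    moreover have "t powr (4 * \<nu>) * m powr (2 * \<nu>) = \<mu> powr (2 * \<nu>)"
    proof -
      have "t powr (4 * \<nu>) = (t\<^sup>2) powr (2 * \<nu>)"
        using \<open>t > 0\<close> powr_powr[of t 2 "2 * \<nu>"] by simp
      then show ?thesis
        using \<open>t > 0\<close> \<open>\<mu> > 0\<close> by (simp add: m_def powr_divide)
    qed
    ultimately show "bessel_primitive \<nu> t \<ge> \<delta>"
      by (simp add: \<delta>_def mult_ac)
  qed
qed

section \<open>Convergence of the primitive at infinity\<close>

lemma bounded_ode_solution:
  fixes w w' :: "real \<Rightarrow> real"
  assumes w: "\<And>t. t \<ge> 1 \<Longrightarrow> (w has_real_derivative w' t) (at t)"
    and w': "\<And>t. t \<ge> 1 \<Longrightarrow> (w' has_real_derivative - (1 + c / t\<^sup>2) * w t) (at t)"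
    and "c \<ge> 0"
  obtains M where "\<And>t. t \<ge> 1 \<Longrightarrow> \<bar>w t\<bar> \<le> M \<and> \<bar>w' t\<bar> \<le> M"
proof
  \<comment> \<open>the energy, which is non-increasing because \<open>c \<ge> 0\<close>\<close>
  define E where "E = (\<lambda>t. (w' t)\<^sup>2 + (1 + c / t\<^sup>2) * (w t)\<^sup>2)"
  fix t :: real assume "t \<ge> 1"
  have "E t \<le> E 1"
  proof (rule DERIV_nonpos_imp_nonincreasing[OF \<open>t \<ge> 1\<close>])
    fix s :: real assume "1 \<le> s" "s \<le> t"
    have "((\<lambda>s. 1 + c / s\<^sup>2) has_real_derivative - 2 * c / s ^ 3) (at s)"
      using \<open>1 \<le> s\<close> by (auto intro!: derivative_eq_intros simp: field_simps power2_eq_square power3_eq_cube)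
    then have "(E has_real_derivative
        (- (1 + c / s\<^sup>2) * w s * w' s + - (1 + c / s\<^sup>2) * w s * w' s)
        + (- 2 * c / s ^ 3 * (w s * w s) + (w' s * w s + w' s * w s) * (1 + c / s\<^sup>2))) (at s)"
      unfolding E_def power2_eq_square[of "w _"] power2_eq_square[of "w' _"]
      by (intro DERIV_add DERIV_mult w[OF \<open>1 \<le> s\<close>] w'[OF \<open>1 \<le> s\<close>])
    \<comment> \<open>The differential equation cancels the products \<open>w * w'\<close>; only the
      derivative of the coefficient \<open>1 + c / s\<^sup>2\<close> survives.\<close>
    then have "(E has_real_derivative - 2 * c / s ^ 3 * (w s)\<^sup>2) (at s)"
      by (rule DERIV_cong) (simp add: algebra_simps power2_eq_square)
    moreover have "- 2 * c / s ^ 3 * (w s)\<^sup>2 \<le> 0"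
      using \<open>c \<ge> 0\<close> \<open>1 \<le> s\<close> by (simp add: mult_nonneg_nonneg)
    ultimately show "\<exists>y. (E has_real_derivative y) (at s) \<and> y \<le> 0" by blast
  qed
  moreover have "(w t)\<^sup>2 \<le> (1 + c / t\<^sup>2) * (w t)\<^sup>2"
    using \<open>c \<ge> 0\<close> by (simp add: distrib_right)
  moreover have "E t = (w' t)\<^sup>2 + (1 + c / t\<^sup>2) * (w t)\<^sup>2"
    by (simp add: E_def)
  ultimately have "(w t)\<^sup>2 \<le> E 1" "(w' t)\<^sup>2 \<le> E 1"
    using zero_le_power2[of "w t"] zero_le_power2[of "w' t"] by linarith+
  then show "\<bar>w t\<bar> \<le> sqrt (E 1) \<and> \<bar>w' t\<bar> \<le> sqrt (E 1)"
    by (auto dest: real_sqrt_le_mono)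
qed

lemma oscillatory_primitive_Cauchy:
  fixes w w' F :: "real \<Rightarrow> real"
  assumes w: "\<And>t. t \<ge> 1 \<Longrightarrow> (w has_real_derivative w' t) (at t)"
    and w': "\<And>t. t \<ge> 1 \<Longrightarrow> (w' has_real_derivative - (1 + c / t\<^sup>2) * w t) (at t)"
    and F: "\<And>t. t \<ge> 1 \<Longrightarrow> (F has_real_derivative t powr p * w t) (at t)"
    and "c \<ge> 0" and "p < 0"
  obtains \<epsilon> where "(\<epsilon> \<longlongrightarrow> 0) at_top"
    and "\<And>r R. 1 \<le> r \<Longrightarrow> r \<le> R \<Longrightarrow> \<bar>F R - F r\<bar> \<le> \<epsilon> r"
proof -
  obtain M where M: "\<And>t. t \<ge> 1 \<Longrightarrow> \<bar>w t\<bar> \<le> M \<and> \<bar>w' t\<bar> \<le> M"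
    using bounded_ode_solution[OF w w' \<open>c \<ge> 0\<close>] by metis
  have "M \<ge> 0" using M[of 1] by linarith
  \<comment> \<open>Integrating \<open>t powr p * w = - t powr p * (w'' + c * w / t\<^sup>2)\<close> by parts twice shows that
    \<open>F + b\<close> has the integrable derivative \<open>O(t powr (p - 2))\<close>, while \<open>b\<close> vanishes at infinity.\<close>
  define b where "b = (\<lambda>t. t powr p * w' t - p * t powr (p - 1) * w t)"
  \<comment> \<open>What remains after cancellation: \<open>c\<close> from the equation,
    \<open>p * (p - 1)\<close> from differentiating \<open>t powr p\<close> twice. Both are
    nonnegative since \<open>p < 0\<close>.\<close>
  define L where "L = c + p * (p - 1)"
  define K where "K = L * M"
  have "L \<ge> 0" using \<open>c \<ge> 0\<close> \<open>p < 0\<close> by (auto simp: L_def intro!: add_nonneg_nonneg mult_nonpos_nonpos)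
  have "K \<ge> 0" using \<open>L \<ge> 0\<close> \<open>M \<ge> 0\<close> by (simp add: K_def)
  have deriv: "((\<lambda>t. F t + b t) has_real_derivative - L * t powr (p - 2) * w t) (at t)" if "t \<ge> 1" for t
  proof -
    have eqs: "t powr p = t powr (p - 2) * t\<^sup>2" "t powr (p - 1) = t powr (p - 2) * t" "p - 1 - 1 = p - 2"
      using that by (simp_all add: powr_diff power2_eq_square)
    have b: "(b has_real_derivative
        (p * t powr (p - 1) * w' t + - (1 + c / t\<^sup>2) * w t * t powr p)
        - (p * ((p - 1) * t powr (p - 1 - 1)) * w t + w' t * (p * t powr (p - 1)))) (at t)"
      unfolding b_def using that
      by (intro DERIV_diff DERIV_mult DERIV_cmult has_real_derivative_powr w w') auto
    from DERIV_add[OF F[OF that] b] show ?thesis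
      by (rule DERIV_cong) (unfold eqs L_def, use that in \<open>simp add: field_simps power2_eq_square\<close>)
  qed
  have bound: "\<bar>- L * t powr (p - 2) * w t\<bar> \<le> K / t\<^sup>2" if "t \<ge> 1" for t
  proof -
    have "t powr (p - 2) \<le> t powr (- 2)"
      using that \<open>p < 0\<close> by (intro powr_mono) auto
    also have "\<dots> = 1 / t\<^sup>2" using that by (simp add: powr_minus_divide)
    finally have "t powr (p - 2) \<le> 1 / t\<^sup>2" .
    then have "(L * t powr (p - 2)) * \<bar>w t\<bar> \<le> (L * (1 / t\<^sup>2)) * M"
      using M[OF that] \<open>L \<ge> 0\<close> by (intro mult_mono mult_left_mono) auto
    then show ?thesis using \<open>L \<ge> 0\<close> by (simp add: abs_mult K_def)
  qed
  have deriv_inv: "((\<lambda>t. k / t) has_real_derivative - (k / t\<^sup>2)) (at t)" if "t \<ge> 1" for t k :: real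
    using that by (auto intro!: derivative_eq_intros simp: power2_eq_square)
  define B where "B = (\<lambda>r. M * r powr p - p * M * r powr (p - 1))"
  \<comment> \<open>\<open>K / r\<close> bounds the variation of \<open>F + b\<close> beyond
    \<open>r\<close>, and \<open>2 * B r\<close> bounds \<open>b\<close> at both ends.\<close>
  define \<epsilon> where "\<epsilon> = (\<lambda>r. K / r + 2 * B r)"
  show thesis
  proof (rule that)
    have "((\<lambda>r. K / r) \<longlongrightarrow> 0) at_top"
      by (rule tendsto_divide_0[OF tendsto_const filterlim_at_top_imp_at_infinity[OF filterlim_ident]])
    moreover have "((\<lambda>r. 2 * B r) \<longlongrightarrow> 2 * (M * 0 - p * M * 0)) at_top"
      unfolding B_def using \<open>p < 0\<close> by (intro tendsto_intros tendsto_neg_powr filterlim_ident) auto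
    ultimately show "(\<epsilon> \<longlongrightarrow> 0) at_top"
      unfolding \<epsilon>_def by (auto dest: tendsto_add)
    fix r R :: real assume rR: "1 \<le> r" "r \<le> R"
    have b: "\<bar>b t\<bar> \<le> B r" if "t \<ge> r" for t
    proof -
      have "t powr p \<le> r powr p" "t powr (p - 1) \<le> r powr (p - 1)"
        using that rR \<open>p < 0\<close> by (auto intro!: powr_mono2')
      then have "t powr p * \<bar>w' t\<bar> \<le> r powr p * M" "t powr (p - 1) * \<bar>w t\<bar> \<le> r powr (p - 1) * M"
        using M[of t] that rR by (auto intro!: mult_mono)
      then have "t powr p * \<bar>w' t\<bar> + - p * (t powr (p - 1) * \<bar>w t\<bar>) \<le> r powr p * M + - p * (r powr (p - 1) * M)"
        using \<open>p < 0\<close> by (intro add_mono mult_left_mono) auto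
      moreover have "\<bar>b t\<bar> \<le> t powr p * \<bar>w' t\<bar> + - p * (t powr (p - 1) * \<bar>w t\<bar>)"
        unfolding b_def using \<open>p < 0\<close> abs_triangle_ineq4[of "t powr p * w' t" "p * t powr (p - 1) * w t"]
        by (simp add: abs_mult)
      ultimately show ?thesis by (simp add: B_def mult_ac)
    qed
    have "F r + b r - K / r \<le> F R + b R - K / R"
    proof (rule DERIV_nonneg_imp_nondecreasing[OF rR(2)])
      fix t assume "r \<le> t" "t \<le> R"
      then have "t \<ge> 1" using rR by simp
      show "\<exists>y. ((\<lambda>t. F t + b t - K / t) has_real_derivative y) (at t) \<and> 0 \<le> y"
        using DERIV_diff[OF deriv[OF \<open>t \<ge> 1\<close>] deriv_inv[OF \<open>t \<ge> 1\<close>, of K]] bound[OF \<open>t \<ge> 1\<close>]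
        by (intro exI conjI) (assumption, linarith)
    qed
    moreover have "F r + b r + K / r \<ge> F R + b R + K / R"
    proof (rule DERIV_nonpos_imp_nonincreasing[OF rR(2)])
      fix t assume "r \<le> t" "t \<le> R"
      then have "t \<ge> 1" using rR by simp
      show "\<exists>y. ((\<lambda>t. F t + b t + K / t) has_real_derivative y) (at t) \<and> y \<le> 0"
        using DERIV_add[OF deriv[OF \<open>t \<ge> 1\<close>] deriv_inv[OF \<open>t \<ge> 1\<close>, of K]] bound[OF \<open>t \<ge> 1\<close>]
        by (intro exI conjI) (assumption, linarith)
    qed
    moreover have "K / R \<ge> 0" using \<open>K \<ge> 0\<close> rR by simp
    ultimately show "\<bar>F R - F r\<bar> \<le> \<epsilon> r"
      using b[OF order_refl] b[OF rR(2)] unfolding \<epsilon>_def by linarith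
  qed
qed

text \<open>The function \<open>w\<close> is
  \<open>2 powr \<nu> * sqrt t * J\<^sub>\<nu>(t)\<close>, which satisfies
  \<open>w'' = -(1 + (1/4 - \<nu>\<^sup>2) / t\<^sup>2) * w\<close>. The bound is uniform in
  \<open>R\<close> because it will be applied at the unknown point of a mean value theorem.\<close>

lemma bessel_primitive_Cauchy:
  assumes \<nu>: "0 < \<nu>" "\<nu> < 1 / 2"
  obtains \<epsilon> where "(\<epsilon> \<longlongrightarrow> 0) at_top"
    and "\<And>r R. 1 \<le> r \<Longrightarrow> r \<le> R \<Longrightarrow> \<bar>bessel_primitive \<nu> R - bessel_primitive \<nu> r\<bar> \<le> \<epsilon> r"
proof -
  define C where "C = (\<lambda>a t. clifford a (- (t\<^sup>2 / 4)))"
  define w where "w = (\<lambda>t. t powr (\<nu> + 1 / 2) * C \<nu> t)"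
  define w' where "w' = (\<lambda>t. (\<nu> + 1 / 2) * t powr (\<nu> - 1 / 2) * C \<nu> t - t powr (\<nu> + 3 / 2) * (C (\<nu> + 1) t / 2))"
  have C: "(C a has_real_derivative - (t / 2) * C (a + 1) t) (at t)" if "a \<ge> 0" for a t
  proof -
    have "((\<lambda>t. - (t\<^sup>2 / 4)) has_real_derivative (- (t / 2))) (at t)"
      by (auto intro!: derivative_eq_intros)
    from DERIV_chain2[OF has_real_derivative_clifford[OF that] this] show ?thesis
      by (simp add: C_def mult.commute)
  qed
  have C_rec: "C \<nu> t = (\<nu> + 1) * C (\<nu> + 1) t - t\<^sup>2 / 4 * C (\<nu> + 2) t" for t
    using clifford_recurrence[of \<nu> "- (t\<^sup>2 / 4)"] \<nu> by (simp add: C_def)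
  show thesis
  proof (rule oscillatory_primitive_Cauchy[of w w' "1 / 4 - \<nu>\<^sup>2" "bessel_primitive \<nu>" "3 * \<nu> - 3 / 2"])
    fix t :: real assume "t \<ge> 1"
    define q where "q = t powr (\<nu> + 1 / 2)"
    have powrs: "t powr (\<nu> - 1 / 2) = q / t" "t powr (\<nu> + 3 / 2) = q * t" "t powr (\<nu> - 3 / 2) = q / t\<^sup>2"
    proof -
      have exps: "\<nu> - 1 / 2 = (\<nu> + 1 / 2) - 1" "\<nu> + 3 / 2 = (\<nu> + 1 / 2) + 1" "\<nu> - 3 / 2 = (\<nu> + 1 / 2) - 2"
        by simp_all
      show "t powr (\<nu> - 1 / 2) = q / t"
        unfolding exps(1) q_def powr_diff[of t "\<nu> + 1 / 2"] using \<open>t \<ge> 1\<close> by simp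
      show "t powr (\<nu> + 3 / 2) = q * t"
        unfolding exps(2) q_def powr_add[of t "\<nu> + 1 / 2"] using \<open>t \<ge> 1\<close> by simp
      show "t powr (\<nu> - 3 / 2) = q / t\<^sup>2"
        unfolding exps(3) q_def powr_diff[of t "\<nu> + 1 / 2"] using \<open>t \<ge> 1\<close> by simp
    qed
    have "(w has_real_derivative
        (\<nu> + 1 / 2) * t powr (\<nu> + 1 / 2 - 1) * C \<nu> t + (- (t / 2) * C (\<nu> + 1) t) * t powr (\<nu> + 1 / 2)) (at t)"
      unfolding w_def using \<open>t \<ge> 1\<close> \<nu>
      by (intro DERIV_mult has_real_derivative_powr C) auto
    then show "(w has_real_derivative w' t) (at t)"
      by (rule DERIV_cong) (simp add: w'_def powrs flip: q_def)
    have "(w' has_real_derivative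
        ((\<nu> + 1 / 2) * ((\<nu> - 1 / 2) * t powr (\<nu> - 1 / 2 - 1)) * C \<nu> t
          + (- (t / 2) * C (\<nu> + 1) t) * ((\<nu> + 1 / 2) * t powr (\<nu> - 1 / 2)))
        - ((\<nu> + 3 / 2) * t powr (\<nu> + 3 / 2 - 1) * (C (\<nu> + 1) t / 2)
          + (- (t / 2) * C (\<nu> + 1 + 1) t) / 2 * t powr (\<nu> + 3 / 2))) (at t)"
      unfolding w'_def using \<open>t \<ge> 1\<close> \<nu>
      by (intro DERIV_diff DERIV_mult DERIV_cmult DERIV_cdivide has_real_derivative_powr C) auto
    moreover have "((\<nu> + 1 / 2) * ((\<nu> - 1 / 2) * t powr (\<nu> - 1 / 2 - 1)) * C \<nu> t
          + (- (t / 2) * C (\<nu> + 1) t) * ((\<nu> + 1 / 2) * t powr (\<nu> - 1 / 2)))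
        - ((\<nu> + 3 / 2) * t powr (\<nu> + 3 / 2 - 1) * (C (\<nu> + 1) t / 2)
          + (- (t / 2) * C (\<nu> + 1 + 1) t) / 2 * t powr (\<nu> + 3 / 2))
        = - (1 + (1 / 4 - \<nu>\<^sup>2) / t\<^sup>2) * w t"
    proof -
      define A1 A2 where "A1 = C (\<nu> + 1) t" and "A2 = C (\<nu> + 2) t"
      have exps: "\<nu> - 1 / 2 - 1 = \<nu> - 3 / 2" "\<nu> + 3 / 2 - 1 = \<nu> + 1 / 2" "\<nu> + 1 + 1 = \<nu> + 2"
        by simp_all
      have wt: "w t = q * C \<nu> t" by (simp add: w_def q_def)
      \<comment> \<open>The recurrence eliminates \<open>C \<nu>\<close>; in terms of
        \<open>A1\<close> and \<open>A2\<close> Bessel's equation is a polynomial identity.\<close>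
      show ?thesis
        unfolding exps powrs wt C_rec[of t] q_def[symmetric] A1_def[symmetric] A2_def[symmetric]
        using \<open>t \<ge> 1\<close> by (simp add: field_simps power2_eq_square)
    qed
    ultimately show "(w' has_real_derivative - (1 + (1 / 4 - \<nu>\<^sup>2) / t\<^sup>2) * w t) (at t)"
      by (rule DERIV_cong)
    have "t powr (4 * \<nu> - 1) = t powr (3 * \<nu> - 3 / 2) * t powr (\<nu> + 1 / 2)"
      by (simp flip: powr_add)
    then show "(bessel_primitive \<nu> has_real_derivative t powr (3 * \<nu> - 3 / 2) * w t) (at t)"
      using has_real_derivative_bessel_primitive[of \<nu> t] \<nu> \<open>t \<ge> 1\<close> by (simp add: w_def C_def mult.assoc)
  next
    have "\<nu>\<^sup>2 \<le> (1 / 2)\<^sup>2" using \<nu> by (intro power_mono) auto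
    then show "1 / 4 - \<nu>\<^sup>2 \<ge> 0" by (simp add: power2_eq_square)
    show "3 * \<nu> - 3 / 2 < 0" using \<nu> by simp
  qed (fact that)
qed

section \<open>Improper integrals with a monotone weight\<close>

text \<open>The product of two proper filters is proper, so limits are unique and the description in
  \<open>improper_integral\<close> denotes the value.\<close>

lemma has_improper_integral_unique:
  assumes "has_improper_integral g I" "has_improper_integral g I'"
  shows "I = I'"
proof (rule tendsto_unique)
  show "(at_right (0::real)) \<times>\<^sub>F (at_top :: real filter) \<noteq> bot"
    by (simp add: prod_filter_eq_bot)
qed (use assms in \<open>auto simp: has_improper_integral_def\<close>)

text \<open>The lower limit \<open>e\<close> is eventually positive, so identities of
  \<open>powr\<close> valid only for \<open>t > 0\<close> suffice.\<close>

lemma has_improper_integral_cong: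
  assumes "\<And>t. t > 0 \<Longrightarrow> g t = h t"
  shows "has_improper_integral g I \<longleftrightarrow> has_improper_integral h I"
proof -
  have "g integrable_on {e..R} \<longleftrightarrow> h integrable_on {e..R}" if "0 < e" for e R
    using that assms by (intro integrable_cong) auto
  moreover have "((\<lambda>(e, R). integral {e..R} g) \<longlongrightarrow> I) (at_right 0 \<times>\<^sub>F at_top)
      \<longleftrightarrow> ((\<lambda>(e, R). integral {e..R} h) \<longlongrightarrow> I) (at_right 0 \<times>\<^sub>F at_top)"
  proof (rule filterlim_cong[OF refl refl])
    have "\<forall>\<^sub>F p in at_right (0::real) \<times>\<^sub>F (at_top :: real filter). fst p > 0 \<and> True"
      by (rule eventually_prodI) (auto simp: eventually_at_filter)
    then show "\<forall>\<^sub>F p in at_right 0 \<times>\<^sub>F at_top. (case p of (e, R) \<Rightarrow> integral {e..R} g)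
        = (case p of (e, R) \<Rightarrow> integral {e..R} h)"
    proof eventually_elim
      case (elim p)
      then show ?case using assms by (auto intro!: integral_cong split: prod.splits)
    qed
  qed
  ultimately show ?thesis by (auto simp: has_improper_integral_def)
qed

text \<open>The second mean value theorem for increasing weights is applied to \<open>- g\<close>,
  and the integrals of \<open>k\<close> are evaluated through \<open>K\<close>.\<close>

lemma second_mean_value_antimono:
  fixes g k K :: "real \<Rightarrow> real"
  assumes "a \<le> b"
    and K: "\<And>t. a \<le> t \<Longrightarrow> t \<le> b \<Longrightarrow> (K has_real_derivative k t) (at t)"
    and g: "\<And>s t. a \<le> s \<Longrightarrow> s \<le> t \<Longrightarrow> t \<le> b \<Longrightarrow> g t \<le> g s"
  obtains c where "c \<in> {a..b}"
    and "((\<lambda>t. g t * k t) has_integral (g a * (K c - K a) + g b * (K b - K c))) {a..b}"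
proof -
  have FTC: "(k has_integral (K d - K c)) {c..d}" if "a \<le> c" "c \<le> d" "d \<le> b" for c d
  proof (rule fundamental_theorem_of_calculus[OF that(2)])
    fix t assume "t \<in> {c..d}"
    then show "(K has_vector_derivative k t) (at t within {c..d})"
      using K[of t] that
      by (auto simp: has_real_derivative_iff_has_vector_derivative intro: has_vector_derivative_at_within)
  qed
  have "k integrable_on {a..b}"
    using FTC[OF order_refl \<open>a \<le> b\<close> order_refl] by blast
  then obtain c where c: "c \<in> {a..b}"
    and int: "((\<lambda>t. - g t * k t) has_integral (- g a * integral {a..c} k + - g b * integral {c..b} k)) {a..b}"
    using second_mean_value_theorem_full[of k a b "\<lambda>t. - g t"] \<open>a \<le> b\<close> g by (auto simp: neg_le_iff_le)
  have "integral {a..c} k = K c - K a" "integral {c..b} k = K b - K c"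
    using FTC c by (auto intro: integral_unique)
  with has_integral_neg[OF int] show thesis
    by (intro that[OF c]) (simp add: add.commute)
qed

lemma Cauchy_imp_convergent_at_top:
  fixes B :: "real \<Rightarrow> real"
  assumes \<epsilon>: "(\<epsilon> \<longlongrightarrow> 0) at_top" and B: "\<And>r R. r0 \<le> r \<Longrightarrow> r \<le> R \<Longrightarrow> \<bar>B R - B r\<bar> \<le> \<epsilon> r"
  obtains b where "(B \<longlongrightarrow> b) at_top"
proof -
  have "cauchy_filter (filtermap B at_top)"
    unfolding cauchy_filter_metric_filtermap
  proof (intro allI impI)
    fix e :: real assume "e > 0"
    then have "\<forall>\<^sub>F r in at_top. \<epsilon> r < e / 2"
      using \<epsilon> by (intro order_tendstoD(2)) auto
    then have "\<forall>\<^sub>F r in at_top. \<epsilon> r < e / 2 \<and> r0 \<le> r"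
      using eventually_ge_at_top[of r0] by (rule eventually_conj)
    then obtain r where r: "\<epsilon> r < e / 2" "r0 \<le> r"
      using eventually_happens'[OF trivial_limit_at_top_linorder] by blast
    have near: "\<bar>B R - B r\<bar> < e / 2" if "R \<ge> r" for R
      using B[OF r(2) that] r(1) by linarith
    have "dist (B R) (B S) < e" if "R \<ge> r" "S \<ge> r" for R S
      using near[OF that(1)] near[OF that(2)] unfolding dist_real_def by linarith
    then show "\<exists>P. eventually P at_top \<and> (\<forall>x y. P x \<and> P y \<longrightarrow> dist (B x) (B y) < e)"
      using eventually_ge_at_top[of r] by blast
  qed
  moreover have "complete (UNIV :: real set)"
    by (rule complete_UNIV)
  ultimately obtain b where "filtermap B at_top \<le> nhds b"
    using cauchy_filter_complete_converges[of "filtermap B at_top" UNIV]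
    by (auto simp: filtermap_bot_iff)
  then show thesis
    by (intro that) (simp add: filterlim_def)
qed

text \<open>The range is split at a fixed \<open>a\<close>. To the left \<open>k \<ge> 0\<close>, so
  \<open>g\<close> may be lowered to \<open>g a\<close>; to the right the mean value theorem
  applies. Together the integral is at least \<open>g a * (\<delta> - K e)\<close>. Without the
  split the factor of \<open>K e\<close> would be \<open>g e\<close>, possibly unbounded as
  \<open>e\<close> tends to 0.\<close>

lemma has_improper_integral_antimono_times:
  fixes g k K :: "real \<Rightarrow> real"
  assumes K: "\<And>t. t > 0 \<Longrightarrow> (K has_real_derivative k t) (at t)"
    and K_0: "(K \<longlongrightarrow> 0) (at_right 0)"
    and K_lower: "\<And>a. a > 0 \<Longrightarrow> \<exists>\<delta>>0. \<forall>t\<ge>a. K t \<ge> \<delta>"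
    and \<epsilon>: "(\<epsilon> \<longlongrightarrow> 0) at_top"
    and K_Cauchy: "\<And>r R. r0 \<le> r \<Longrightarrow> r \<le> R \<Longrightarrow> \<bar>K R - K r\<bar> \<le> \<epsilon> r"
    and g_antimono: "antimono_on {0<..} g"
    and g_nonneg: "\<And>t. t > 0 \<Longrightarrow> g t \<ge> 0"
    and g_nonzero: "t0 > 0" "g t0 \<noteq> 0"
    and "d > 0" and k_nonneg: "\<And>t. 0 < t \<Longrightarrow> t \<le> d \<Longrightarrow> k t \<ge> 0"
    and int_0: "(\<lambda>t. g t * k t) integrable_on {0..d}"
  shows "\<exists>I>0. has_improper_integral (\<lambda>t. g t * k t) I"
proof -
  define h where "h = (\<lambda>t. g t * k t)"
  have g_le: "g t \<le> g s" if "0 < s" "s \<le> t" for s t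
    using monotone_onD[OF g_antimono, of s t] that by simp
  \<comment> \<open>\<open>a \<le> d\<close> gives \<open>k\<close> its sign on
    \<open>{0<..a}\<close>, and \<open>a \<le> t0\<close> gives
    \<open>g a \<ge> g t0 > 0\<close>.\<close>
  define a where "a = min d t0"
  have a: "0 < a" "a \<le> d" using \<open>d > 0\<close> \<open>t0 > 0\<close> by (auto simp: a_def)
  have "g a > 0"
    using g_le[of a t0] g_nonneg[of t0] g_nonzero a by (auto simp: a_def)
  obtain \<delta> where "\<delta> > 0" and \<delta>: "\<And>t. t \<ge> a \<Longrightarrow> K t \<ge> \<delta>"
    using K_lower[OF a(1)] by auto
  have mean_value: "\<exists>c\<in>{e..R}. (h has_integral (g e * (K c - K e) + g R * (K R - K c))) {e..R}"
    if "0 < e" "e \<le> R" for e R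
  proof (rule second_mean_value_antimono[of e R K k g])
    show "(K has_real_derivative k t) (at t)" if "e \<le> t" for t
      using \<open>0 < e\<close> that by (intro K) simp
    show "g t \<le> g s" if "e \<le> s" "s \<le> t" for s t
      using \<open>0 < e\<close> that by (intro g_le) simp_all
  qed (use that in \<open>auto simp: h_def\<close>)
  then have h_integrable: "h integrable_on {e..R}" if "0 < e" "e \<le> R" for e R
    using that by blast
  have combine: "integral {e..a} h + integral {a..R} h = integral {e..R} h" if "0 < e" "e \<le> a" "a \<le> R" for e R
    using that h_integrable[of e R] by (intro Henstock_Kurzweil_Integration.integral_combine) auto

  define B where "B = (\<lambda>R. integral {a..R} h)"
  \<comment> \<open>The factor 3 is \<open>1 + 2\<close>: as \<open>\<epsilon>\<close> need not be
    monotone, \<open>K R\<close> and \<open>K c\<close> are both compared with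
    \<open>K r\<close>.\<close>
  have B_Cauchy: "\<bar>B R - B r\<bar> \<le> 3 * g a * \<epsilon> r" if "max a r0 \<le> r" "r \<le> R" for r R
  proof -
    have r: "a \<le> r" "r0 \<le> r" "0 < r" using that a by auto
    obtain c where c: "r \<le> c" "c \<le> R"
      and int: "(h has_integral (g r * (K c - K r) + g R * (K R - K c))) {r..R}"
      using mean_value[OF \<open>0 < r\<close> \<open>r \<le> R\<close>] by auto
    have "B R - B r = integral {r..R} h"
      using Henstock_Kurzweil_Integration.integral_combine[of a r R h] h_integrable[of a R] a r that
      by (simp add: B_def)
    also have "\<dots> = g r * (K c - K r) + g R * (K R - K c)"
      using int by (rule integral_unique)
    finally have "\<bar>B R - B r\<bar> \<le> g r * \<bar>K c - K r\<bar> + g R * \<bar>K R - K c\<bar>"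
      using abs_triangle_ineq[of "g r * (K c - K r)" "g R * (K R - K c)"] g_nonneg[of r] g_nonneg[of R] r that
      by (simp add: abs_mult)
    also have "\<dots> \<le> g a * \<epsilon> r + g a * (2 * \<epsilon> r)"
    proof (intro add_mono mult_mono)
      show "g r \<le> g a" "g R \<le> g a" using g_le a r that by auto
      show c_r: "\<bar>K c - K r\<bar> \<le> \<epsilon> r" by (rule K_Cauchy[OF r(2) c(1)])
      have "\<bar>K R - K r\<bar> \<le> \<epsilon> r" by (rule K_Cauchy[OF r(2) that(2)])
      with c_r show "\<bar>K R - K c\<bar> \<le> 2 * \<epsilon> r" by linarith
    qed (use \<open>g a > 0\<close> in auto)
    finally show ?thesis by (simp add: mult_ac)
  qed
  have "((\<lambda>r. 3 * g a * \<epsilon> r) \<longlongrightarrow> 0) at_top"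
    using tendsto_mult_left[OF \<epsilon>, of "3 * g a"] by simp
  then obtain b where b: "(B \<longlongrightarrow> b) at_top"
    by (rule Cauchy_imp_convergent_at_top[OF _ B_Cauchy])

  \<comment> \<open>Integrability down to 0 makes \<open>A\<close> continuous at 0, which settles
    the lower limit.\<close>
  define A where "A = (\<lambda>e. integral {e..a} h)"
  have "h integrable_on {0..a}"
    using integrable_on_subinterval[OF int_0] a by (simp add: h_def)
  then have "continuous_on {0..a} A"
    unfolding A_def by (rule indefinite_integral_continuous_1')
  then have A: "(A \<longlongrightarrow> A 0) (at_right 0)"
    using a(1) by (rule continuous_on_Icc_at_rightD)

  let ?F = "at_right (0::real) \<times>\<^sub>F (at_top :: real filter)"
  have fst: "filterlim fst (at_right 0) ?F" and snd: "filterlim snd at_top ?F"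
    by (rule filterlim_fst filterlim_snd)+
  have ev: "\<forall>\<^sub>F p in ?F. (0 < fst p \<and> fst p < a) \<and> a < snd p"
    using eventually_at_right_real[OF a(1)] eventually_gt_at_top[of a]
    by (intro eventually_prodI) auto
  \<comment> \<open>Splitting at \<open>a\<close> decouples the joint limit into two limits in one
    variable.\<close>
  have "((\<lambda>p. A (fst p) + B (snd p)) \<longlongrightarrow> A 0 + b) ?F"
    by (intro tendsto_add filterlim_compose[OF A fst] filterlim_compose[OF b snd])
  moreover have "\<forall>\<^sub>F p in ?F. A (fst p) + B (snd p) = (case p of (e, R) \<Rightarrow> integral {e..R} h)"
    using ev by eventually_elim (auto simp: A_def B_def combine split: prod.splits)
  ultimately have lim: "((\<lambda>(e, R). integral {e..R} h) \<longlongrightarrow> A 0 + b) ?F"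
    by (rule Lim_transform_eventually)

  have lower: "g a * (\<delta> - K e) \<le> integral {e..R} h" if "0 < e" "e < a" "a < R" for e R
  proof -
    have "g a * (K a - K e) \<le> A e"
    proof -
      have "((\<lambda>t. g a * k t) has_integral (g a * (K a - K e))) {e..a}"
      proof (intro has_integral_mult_right fundamental_theorem_of_calculus)
        fix t assume "t \<in> {e..a}"
        then show "(K has_vector_derivative k t) (at t within {e..a})"
          using K[of t] that
          by (auto simp: has_real_derivative_iff_has_vector_derivative intro: has_vector_derivative_at_within)
      qed (use that in simp)
      moreover have "(h has_integral A e) {e..a}"
        unfolding A_def using h_integrable that by (auto intro: integrable_integral)
      ultimately show ?thesis
      proof (rule has_integral_le)
        fix t assume "t \<in> {e..a}"
        then show "g a * k t \<le> h t"
          unfolding h_def using that a g_le[of t a] k_nonneg[of t] by (intro mult_right_mono) auto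
      qed
    qed
    moreover have "g a * \<delta> - g a * K a \<le> B R"
    proof -
      obtain c where c: "a \<le> c" "c \<le> R"
        and int: "(h has_integral (g a * (K c - K a) + g R * (K R - K c))) {a..R}"
        using mean_value[OF a(1) less_imp_le[OF \<open>a < R\<close>]] by auto
      \<comment> \<open>Abel summation: the weights \<open>g a - g R\<close> and \<open>g R\<close>
        are nonnegative, and both \<open>c\<close> and \<open>R\<close> are at least
        \<open>a\<close>, where \<open>K \<ge> \<delta>\<close>.\<close>
      have "g a * \<delta> = (g a - g R) * \<delta> + g R * \<delta>" by (simp add: algebra_simps)
      also have "\<dots> \<le> (g a - g R) * K c + g R * K R"
        using \<delta>[of c] \<delta>[of R] c that a g_le[of a R] g_nonneg[of R]
        by (intro add_mono mult_left_mono) auto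
      finally have "g a * \<delta> - g a * K a \<le> g a * (K c - K a) + g R * (K R - K c)"
        by (simp add: algebra_simps)
      also have "\<dots> = B R" unfolding B_def using int by (simp add: integral_unique)
      finally show ?thesis .
    qed
    ultimately have "g a * (\<delta> - K e) \<le> A e + B R" by (simp add: algebra_simps)
    then show ?thesis using combine[of e R] that by (simp add: A_def B_def)
  qed
  have "((\<lambda>p. g a * (\<delta> - K (fst p))) \<longlongrightarrow> g a * (\<delta> - 0)) ?F"
    by (intro tendsto_intros filterlim_compose[OF K_0 fst])
  moreover have "\<forall>\<^sub>F p in ?F. g a * (\<delta> - K (fst p)) \<le> (case p of (e, R) \<Rightarrow> integral {e..R} h)"
    using ev by eventually_elim (auto simp: lower split: prod.splits)
  ultimately have "g a * (\<delta> - 0) \<le> A 0 + b"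
    using lim by (intro tendsto_le[of ?F]) (auto simp: prod_filter_eq_bot)
  then have "g a * \<delta> \<le> A 0 + b" by simp
  then have "A 0 + b > 0"
    using mult_pos_pos[OF \<open>g a > 0\<close> \<open>\<delta> > 0\<close>] by linarith
  moreover have "has_improper_integral h (A 0 + b)"
    unfolding has_improper_integral_def using h_integrable lim by auto
  ultimately show ?thesis unfolding h_def by blast
qed

section \<open>Positivity of the Hankel transform\<close>

text \<open>This isolates \<open>t powr (\<nu> + 1 / 2) * f t\<close>, the function assumed
  integrable near 0; the remaining factor is continuous.\<close>

lemma hankel_integrand_eq:
  assumes "\<nu> > 0" "x > 0" "t > 0"
  shows "hankel_integrand \<nu> f x t = 2 powr - \<nu> * x powr (\<nu> + 1 / 2)
    * (t powr (\<nu> + 1 / 2) * f t) * clifford \<nu> (- ((x * t)\<^sup>2 / 4))"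
proof -
  have "(x * t / 2) powr \<nu> * sqrt (x * t) = 2 powr - \<nu> * x powr (\<nu> + 1 / 2) * t powr (\<nu> + 1 / 2)"
  proof -
    have "(x * t / 2) powr \<nu> * sqrt (x * t) = (x * t) powr \<nu> / 2 powr \<nu> * (x * t) powr (1 / 2)"
      using assms by (simp add: powr_divide powr_half_sqrt)
    also have "\<dots> = 2 powr - \<nu> * (x * t) powr (\<nu> + 1 / 2)"
      by (simp add: powr_add powr_minus_divide)
    also have "(x * t) powr (\<nu> + 1 / 2) = x powr (\<nu> + 1 / 2) * t powr (\<nu> + 1 / 2)"
      using assms by (simp add: powr_mult)
    finally show ?thesis by simp
  qed
  then have "f t * clifford \<nu> (- ((x * t)\<^sup>2 / 4)) * ((x * t / 2) powr \<nu> * sqrt (x * t))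
      = f t * clifford \<nu> (- ((x * t)\<^sup>2 / 4)) * (2 powr - \<nu> * x powr (\<nu> + 1 / 2) * t powr (\<nu> + 1 / 2))"
    by (simp only:)
  moreover have "bessel_J \<nu> (x * t) = (x * t / 2) powr \<nu> * clifford \<nu> (- ((x * t)\<^sup>2 / 4))"
    using assms by (intro bessel_J_clifford) auto
  ultimately show ?thesis
    unfolding hankel_integrand_def by (simp only: mult_ac)
qed

theorem theorem5p2:
  fixes \<nu> :: real and f :: "real \<Rightarrow> real"
  assumes "0 < \<nu>" and "\<nu> < 1 / 2"
    and "\<And>t. t > 0 \<Longrightarrow> f t \<ge> 0"
    and "sectionally_continuous f"
    and "\<exists>t>0. f t \<noteq> 0"
    and "antimono_on {0<..} (\<lambda>t. t powr (3 / 2 - 3 * \<nu>) * f t)"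
    and "(\<integral>\<^sup>+ t \<in> {0<..<1}. ennreal (t powr (\<nu> + 1 / 2) * f t) \<partial>lborel) < \<infinity>"
  shows "\<forall>x>0. improper_integrable (hankel_integrand \<nu> f x) \<and> hankel \<nu> f x > 0"
proof (intro allI impI)
  fix x :: real assume "x > 0"
  note \<nu> = assms(1,2) and f_nonneg = assms(3) and antimono = assms(6)
  define g where "g = (\<lambda>t. t powr (3 / 2 - 3 * \<nu>) * f t)"
  define \<phi> where "\<phi> = (\<lambda>t. t powr (\<nu> + 1 / 2) * f t)"
  define cl where "cl = (\<lambda>t. clifford \<nu> (- ((x * t)\<^sup>2 / 4)))"
  define C where "C = 2 powr - \<nu> * x powr (\<nu> + 1 / 2)"
  define k where "k = (\<lambda>t. C * (t powr (4 * \<nu> - 1) * cl t))"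
  \<comment> \<open>The power of \<open>x\<close> compensates the substitution
    \<open>t \<mapsto> x * t\<close>, which turns \<open>t powr (4 * \<nu> - 1)\<close> into
    \<open>x powr (4 * \<nu>)\<close> times itself.\<close>
  define A where "A = C * x powr (- 4 * \<nu>)"
  define K where "K = (\<lambda>t. A * bessel_primitive \<nu> (x * t))"
  have "C > 0" using \<open>x > 0\<close> by (simp add: C_def)
  have "A > 0" using \<open>x > 0\<close> \<open>C > 0\<close> by (simp add: A_def)
  have g_antimono: "antimono_on {0<..} g" using antimono by (simp only: g_def)
  have \<phi>_g: "\<phi> t = t powr (4 * \<nu> - 1) * g t" if "t > 0" for t
  proof -
    have "t powr (4 * \<nu> - 1) * t powr (3 / 2 - 3 * \<nu>) = t powr (\<nu> + 1 / 2)"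
      by (subst powr_add[symmetric], rule arg_cong[where f = "\<lambda>u. t powr u"]) simp
    then show ?thesis
      unfolding \<phi>_def g_def mult.assoc[symmetric] by (simp only:)
  qed
  have eq: "hankel_integrand \<nu> f x t = g t * k t" if "t > 0" for t
    using hankel_integrand_eq[OF \<nu>(1) \<open>x > 0\<close> that, of f] \<phi>_g[OF that]
    by (simp add: k_def C_def cl_def \<phi>_def)
  have cl_cont: "continuous_on S cl" for S
  proof -
    have "isCont (clifford \<nu>) y" for y
      using \<nu> by (intro DERIV_isCont[OF has_real_derivative_clifford]) simp
    then have "continuous_on UNIV (clifford \<nu>)"
      by (simp add: continuous_on_eq_continuous_at)
    then show ?thesis
      unfolding cl_def by (rule continuous_on_compose2) (auto intro!: continuous_intros)
  qed
  obtain \<eta> where "\<eta> > 0" and \<eta>: "\<And>y. \<bar>y\<bar> \<le> \<eta> \<Longrightarrow> clifford \<nu> y \<ge> rGamma (\<nu> + 1) / 2"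
    using clifford_pos_near_0[OF \<nu>(1)] by metis
  \<comment> \<open>\<open>t \<le> 2 * sqrt \<eta> / x\<close> means
    \<open>(x * t)\<^sup>2 / 4 \<le> \<eta>\<close>, where the kernel is nonnegative; 1 keeps
    \<open>{0..d}\<close> in the range of the integrability assumption.\<close>
  define d where "d = min 1 (2 * sqrt \<eta> / x)"
  have d: "0 < d" "d \<le> 1" using \<open>\<eta> > 0\<close> \<open>x > 0\<close> by (auto simp: d_def)

  have "\<exists>I>0. has_improper_integral (\<lambda>t. g t * k t) I"
  proof -
    obtain t0 where t0: "t0 > 0" "f t0 \<noteq> 0" using assms(5) by blast
    obtain \<epsilon> where \<epsilon>: "(\<epsilon> \<longlongrightarrow> 0) at_top"
      and F_Cauchy: "\<And>r R. 1 \<le> r \<Longrightarrow> r \<le> R \<Longrightarrow> \<bar>bessel_primitive \<nu> R - bessel_primitive \<nu> r\<bar> \<le> \<epsilon> r"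
      using bessel_primitive_Cauchy[OF \<nu>] by metis
    show ?thesis
    proof (rule has_improper_integral_antimono_times)
      show "(K has_real_derivative k t) (at t)" if "t > 0" for t
      proof -
        have "(bessel_primitive \<nu> has_real_derivative (x * t) powr (4 * \<nu> - 1) * cl t) (at (x * t))"
          unfolding cl_def using \<nu> \<open>x > 0\<close> that by (intro has_real_derivative_bessel_primitive) auto
        moreover have "((\<lambda>t. x * t) has_real_derivative x) (at t)"
          by (auto intro!: derivative_eq_intros)
        ultimately have "((\<lambda>t. bessel_primitive \<nu> (x * t)) has_real_derivative
            (x * t) powr (4 * \<nu> - 1) * cl t * x) (at t)"
          by (rule DERIV_chain2)
        then have "(K has_real_derivative A * ((x * t) powr (4 * \<nu> - 1) * cl t * x)) (at t)"
          unfolding K_def by (rule DERIV_cmult)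
        moreover have "A * ((x * t) powr (4 * \<nu> - 1) * cl t * x) = k t"
        proof -
          have "x powr (- 4 * \<nu>) * (x powr (4 * \<nu> - 1) * x) = 1"
            using \<open>x > 0\<close> by (simp add: powr_diff powr_minus_divide)
          moreover have "(x * t) powr (4 * \<nu> - 1) = x powr (4 * \<nu> - 1) * t powr (4 * \<nu> - 1)"
            using \<open>x > 0\<close> that by (simp add: powr_mult)
          ultimately have "C * cl t * (x powr (- 4 * \<nu>) * ((x * t) powr (4 * \<nu> - 1) * x))
              = C * cl t * t powr (4 * \<nu> - 1)"
            by (simp only: mult_ac mult_1_left mult_1_right) (simp add: mult_ac)
          then show ?thesis
            unfolding A_def k_def by (simp only: mult_ac)
        qed
        ultimately show ?thesis by simp
      qed
      have "filterlim (\<lambda>t. x * t) (at_right 0) (at_right 0)"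
        unfolding filterlim_at
        using \<open>x > 0\<close> by (auto simp: eventually_at_filter intro!: tendsto_eq_intros)
      then have "((\<lambda>t. bessel_primitive \<nu> (x * t)) \<longlongrightarrow> 0) (at_right 0)"
        by (rule filterlim_compose[OF bessel_primitive_tendsto_0[OF \<nu>(1)]])
      from tendsto_mult_left[OF this, of A] show "(K \<longlongrightarrow> 0) (at_right 0)"
        by (simp add: K_def)
      show "\<exists>\<delta>>0. \<forall>t\<ge>a. K t \<ge> \<delta>" if "a > 0" for a
      proof -
        obtain \<delta> where "\<delta> > 0" and \<delta>: "\<And>t. t \<ge> x * a \<Longrightarrow> bessel_primitive \<nu> t \<ge> \<delta>"
          using bessel_primitive_lower_bound[OF \<nu> mult_pos_pos[OF \<open>x > 0\<close> \<open>a > 0\<close>]] by metis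
        show ?thesis
          using \<open>\<delta> > 0\<close> \<open>A > 0\<close> \<delta> \<open>x > 0\<close>
          by (intro exI[of _ "A * \<delta>"]) (auto simp: K_def)
      qed
      have "filterlim (\<lambda>r. x * r) at_top at_top"
        using \<open>x > 0\<close> by (intro filterlim_tendsto_pos_mult_at_top[OF tendsto_const _ filterlim_ident])
      then have "((\<lambda>r. \<epsilon> (x * r)) \<longlongrightarrow> 0) at_top"
        by (rule filterlim_compose[OF \<epsilon>])
      from tendsto_mult_left[OF this, of A] show "((\<lambda>r. A * \<epsilon> (x * r)) \<longlongrightarrow> 0) at_top"
        by simp
      \<comment> \<open>The threshold \<open>1 / x\<close> ensures
        \<open>x * r \<ge> 1\<close>.\<close>
      show "\<bar>K R - K r\<bar> \<le> A * \<epsilon> (x * r)" if "1 / x \<le> r" "r \<le> R" for r R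
      proof -
        have "\<bar>bessel_primitive \<nu> (x * R) - bessel_primitive \<nu> (x * r)\<bar> \<le> \<epsilon> (x * r)"
          using that \<open>x > 0\<close> by (intro F_Cauchy) (auto simp: field_simps)
        then have "A * \<bar>bessel_primitive \<nu> (x * R) - bessel_primitive \<nu> (x * r)\<bar> \<le> A * \<epsilon> (x * r)"
          using \<open>A > 0\<close> by (intro mult_left_mono) auto
        moreover have "K R - K r = A * (bessel_primitive \<nu> (x * R) - bessel_primitive \<nu> (x * r))"
          by (simp add: K_def algebra_simps)
        ultimately show ?thesis using \<open>A > 0\<close> by (simp add: abs_mult)
      qed
      show "antimono_on {0<..} g" by (fact g_antimono)
      show "g t \<ge> 0" if "t > 0" for t using f_nonneg[OF that] by (simp add: g_def)
      show "t0 > 0" "g t0 \<noteq> 0" using t0 by (auto simp: g_def)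
      show "d > 0" by (fact d)
      show "k t \<ge> 0" if "0 < t" "t \<le> d" for t
      proof -
        have "x * t \<le> 2 * sqrt \<eta>"
          using that \<open>x > 0\<close> by (simp add: d_def field_simps)
        then have "(x * t)\<^sup>2 \<le> (2 * sqrt \<eta>)\<^sup>2"
          using that \<open>x > 0\<close> by (intro power_mono) auto
        then have "\<bar>- ((x * t)\<^sup>2 / 4)\<bar> \<le> \<eta>"
          using \<open>\<eta> > 0\<close> by (simp add: power_mult_distrib)
        from \<eta>[OF this] have "cl t \<ge> rGamma (\<nu> + 1) / 2" by (simp add: cl_def)
        moreover have "rGamma (\<nu> + 1) \<ge> 0"
          using \<nu> by (simp add: rGamma_inverse_Gamma Gamma_real_nonneg)
        ultimately show ?thesis using \<open>C > 0\<close> by (simp add: k_def)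
      qed
      show "(\<lambda>t. g t * k t) integrable_on {0..d}"
      proof -
        \<comment> \<open>Monotonicity of \<open>g\<close> supplies the measurability of
          \<open>\<phi>\<close> on the unit interval.\<close>
        have "mono_on {0<..} (\<lambda>t. - g t)"
          using g_antimono by (auto simp: monotone_on_def)
        then have "(\<lambda>t. - g t) \<in> borel_measurable (restrict_space borel {0<..})"
          by (rule borel_measurable_mono_on_fnc)
        then have "(\<lambda>t. indicator {0<..} t *\<^sub>R (- g t)) \<in> borel_measurable borel"
          by (subst (asm) borel_measurable_restrict_space_iff) auto
        then have "(\<lambda>t. indicator {0<..<1} t * (t powr (4 * \<nu> - 1) * - (indicator {0<..} t *\<^sub>R (- g t)))) \<in> borel_measurable borel"
          by measurable
        also have "(\<lambda>t. indicator {0<..<1} t * (t powr (4 * \<nu> - 1) * - (indicator {0<..} t *\<^sub>R (- g t))))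
            = (\<lambda>t. indicator {0<..<1} t *\<^sub>R \<phi> t)"
          by (auto simp: fun_eq_iff indicator_def \<phi>_g)
        finally have meas: "(\<lambda>t. indicator {0<..<1} t *\<^sub>R \<phi> t) \<in> borel_measurable borel" .
        \<comment> \<open>Compactness bounds \<open>cl\<close>, so \<open>M * \<phi>\<close>
          dominates \<open>\<phi> * cl\<close>.\<close>
        have "bounded (cl ` {0..1})"
          by (intro compact_imp_bounded compact_continuous_image cl_cont compact_Icc)
        then obtain M where M: "\<forall>t\<in>{0..1}. \<bar>cl t\<bar> \<le> M"
          unfolding bounded_iff by auto
        have "integrable lborel (\<lambda>t. indicator {0<..<1} t *\<^sub>R \<phi> t)"
        proof (rule integrableI_nonneg)
          have "(\<integral>\<^sup>+ t. ennreal (indicator {0<..<1} t *\<^sub>R \<phi> t) \<partial>lborel)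
              = (\<integral>\<^sup>+ t \<in> {0<..<1}. ennreal (\<phi> t) \<partial>lborel)"
            by (intro nn_integral_cong) (auto simp: indicator_def)
          then show "(\<integral>\<^sup>+ t. ennreal (indicator {0<..<1} t *\<^sub>R \<phi> t) \<partial>lborel) < \<infinity>"
            using assms(7) by (simp add: \<phi>_def)
        qed (use meas f_nonneg in \<open>auto simp: \<phi>_def indicator_def\<close>)
        then have "integrable lborel (\<lambda>t. M *\<^sub>R (indicator {0<..<1} t *\<^sub>R \<phi> t))"
          by (rule integrable_scaleR_right)
        then have "integrable lborel (\<lambda>t. (indicator {0<..<1} t *\<^sub>R \<phi> t) * cl t)"
        proof (rule Bochner_Integration.integrable_bound)
          show "AE t in lborel. norm ((indicator {0<..<1} t *\<^sub>R \<phi> t) * cl t) \<le> norm (M *\<^sub>R (indicator {0<..<1} t *\<^sub>R \<phi> t))"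
          proof (intro AE_I2)
            fix t :: real
            have "\<bar>\<phi> t\<bar> * \<bar>cl t\<bar> \<le> \<bar>\<phi> t\<bar> * \<bar>M\<bar>" if "t \<in> {0<..<1}"
              using bspec[OF M, of t] that by (intro mult_left_mono) auto
            then show "norm ((indicator {0<..<1} t *\<^sub>R \<phi> t) * cl t) \<le> norm (M *\<^sub>R (indicator {0<..<1} t *\<^sub>R \<phi> t))"
              by (auto simp: indicator_def abs_mult mult.commute)
          qed
          have "cl \<in> borel_measurable borel"
            by (rule borel_measurable_continuous_onI[OF cl_cont])
          with meas show "(\<lambda>t. (indicator {0<..<1} t *\<^sub>R \<phi> t) * cl t) \<in> borel_measurable lborel"
            by simp
        qed
        then have "set_integrable lborel {0<..<1} (\<lambda>t. \<phi> t * cl t)"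
          by (simp add: set_integrable_def mult.assoc)
        then have "(\<lambda>t. \<phi> t * cl t) integrable_on {0<..<1}"
          by (rule set_borel_integral_eq_integral(1))
        then have "(\<lambda>t. C * (\<phi> t * cl t)) integrable_on {0<..<1}"
          by (rule integrable_on_mult_right)
        moreover have "C * (\<phi> t * cl t) = g t * k t" if "t \<in> {0<..<1}" for t
          using that \<phi>_g[of t] by (simp add: k_def)
        ultimately have "(\<lambda>t. g t * k t) integrable_on {0<..<1}"
          by (rule integrable_eq)
        then have "(\<lambda>t. g t * k t) integrable_on {0..1}"
          by (simp add: integrable_on_Icc_iff_Ioo)
        then show ?thesis
          by (rule integrable_on_subinterval) (use d in auto)
      qed
    qed
  qed
  then obtain I where "I > 0" and I: "has_improper_integral (hankel_integrand \<nu> f x) I"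
    using has_improper_integral_cong[of "hankel_integrand \<nu> f x" "\<lambda>t. g t * k t"] eq by metis
  have "hankel \<nu> f x = I"
    unfolding hankel_def improper_integral_def
    using I has_improper_integral_unique by blast
  with I \<open>I > 0\<close> show "improper_integrable (hankel_integrand \<nu> f x) \<and> hankel \<nu> f x > 0"
    unfolding improper_integrable_def by blast
qed

end
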